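(* Let $\mathbf{c}=((\tau,d,\rho),\leq,\mu)$ be a compact TOM tree and let $m=\mu(\tau)$. There exists a càdlàg function $f_{\mathbf{c}}:[0,m]\to[0,\infty)$ with no negative jumps such that the tree coded by $f_{\mathbf{c}}$ is isomorphic to $\mathbf{c}$. In particular, if $\mathbf{c}$ and $\tilde{\mathbf{c}}$ are non-isomorphic compact TOM trees, then $f_{\mathbf{c}}\neq f_{\tilde{\mathbf{c}}}$.
   Context: Real trees. A real tree is a complete metric space $(\tau,d)$ such that (i) for all $\sigma_1,\sigma_2\in\tau$ there is a unique isometric embedding $\phi_{\sigma_1,\sigma_2}:[0,d(\sigma_1,\sigma_2)]\to\tau$ sending $0$ to $\sigma_1$ and $d(\sigma_1,\sigma_2)$ to $\sigma_2$; (ii) every injective continuous $\phi:[0,1]\to\tau$ with $\phi(0)=\sigma_1,\phi(1)=\sigma_2$ has the same image as $\phi_{\sigma_1,\sigma_2}$. It is rooted if a point $\rho\in\tau$ is distinguished. $[\sigma_1,\sigma_2]$ is the image of $\phi_{\sigma_1,\sigma_2}$; half-open and open intervals are obtained by removing endpoints. $\sigma_1\preceq\sigma_2$ iff $\sigma_1\in[\rho,\sigma_2]$. $\sigma_1\wedge\sigma_2$ is the unique point with $[\rho,\sigma_1]\cap[\rho,\sigma_2]=[\rho,\sigma_1\wedge\sigma_2]$. TOM trees. A TOM (totally ordered measured) tree is $\mathbf{c}=((\tau,d,\rho),\leq,\mu)$ where $(\tau,d,\rho)$ is a rooted real tree, $\leq$ is a total order on $\tau$ with (Or1) $\sigma_1\preceq\sigma_2$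 implies $\sigma_2\leq\sigma_1$; (Or2) $\sigma_1<\sigma_2$ implies that every element of $[\sigma_1,\sigma_1\wedge\sigma_2)$ is $<\sigma_2$; and $\mu$ is a measure on the Borel sets of $\tau$ with (Mes1) $\mu$ is locally finite and $\mu(\{\sigma:\sigma_1\leq\sigma\leq\sigma_2\})>0$ whenever $\sigma_1<\sigma_2$; (Mes2) $\mu$ is diffuse (no atoms). It is compact if $\tau$ is compact. Two compact TOM trees are isomorphic if there is an isometry from one onto the other that preserves the total order and maps one measure to the other. Tree coded by a function. Let $f:[0,m]\to[0,\infty)$ be càdlàg with non-negative jumps and $f(m)=0$ (this is part of what is meant by "the tree coded by $f$"). Put $d_f(t_1,t_2)=f(t_1)+f(t_2)-2\inf_{t\in[t_1,t_2]}f(t)$ for $t_1\le t_2$ (extended symmetrically), and $t_1\sim_f t_2$ iff $d_f(t_1,t_2)=0$. The quotient $\tau_f=[0,m]/\!\sim_f$ with the induced distance $d_f$, rooted at the class of $m$, is a compact rooted real tree. It carries the total order: $\sigma_1\leq\sigma_2$ iff $\sup\sigma_1\leq\sup\sigma_2$ (classes viewed as subsets of $[0,m]$), and the measure equal to the push-forward of Lebesgue measure on $[0,m]$ under the canonical projection. The tree coded by $f$ is $\tau_f$ with this root, order and measure. *)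

theory Defs
  imports "HOL-Analysis.Analysis"
begin

section \<open>Rooted real trees\<close>

text \<open>A metric space is given by a carrier \<open>T\<close> and a distance \<open>d\<close>, as in the locale
  \<^locale>\<open>Metric_space\<close>. Paths are made extensional so that uniqueness of the geodesic
  is uniqueness as a function on \<open>[0, d x y]\<close>.\<close>

definition is_geodesic ::
    "'a set \<Rightarrow> ('a \<Rightarrow> 'a \<Rightarrow> real) \<Rightarrow> 'a \<Rightarrow> 'a \<Rightarrow> (real \<Rightarrow> 'a) \<Rightarrow> bool" where
  "is_geodesic T d x y \<phi> \<longleftrightarrow>
     \<phi> \<in> {0..d x y} \<rightarrow>\<^sub>E T \<and>
     (\<forall>s\<in>{0..d x y}. \<forall>t\<in>{0..d x y}. d (\<phi> s) (\<phi> t) = \<bar>s - t\<bar>) \<and>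
     \<phi> 0 = x \<and> \<phi> (d x y) = y"

definition segment ::
    "'a set \<Rightarrow> ('a \<Rightarrow> 'a \<Rightarrow> real) \<Rightarrow> 'a \<Rightarrow> 'a \<Rightarrow> 'a set" where
  "segment T d x y = (THE \<phi>. is_geodesic T d x y \<phi>) ` {0..d x y}"

definition real_tree :: "'a set \<Rightarrow> ('a \<Rightarrow> 'a \<Rightarrow> real) \<Rightarrow> bool" where
  "real_tree T d \<longleftrightarrow>
     Metric_space T d \<and> Metric_space.mcomplete T d \<and>
     (\<forall>x\<in>T. \<forall>y\<in>T. \<exists>!\<phi>. is_geodesic T d x y \<phi>) \<and>
     (\<forall>x\<in>T. \<forall>y\<in>T. \<forall>\<phi>.
        continuous_map (top_of_set {0..1}) (Metric_space.mtopology T d) \<phi> \<and>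
        inj_on \<phi> {0..1::real} \<and> \<phi> 0 = x \<and> \<phi> 1 = y
        \<longrightarrow> \<phi> ` {0..1} = segment T d x y)"

definition rooted_real_tree :: "'a set \<Rightarrow> ('a \<Rightarrow> 'a \<Rightarrow> real) \<Rightarrow> 'a \<Rightarrow> bool" where
  "rooted_real_tree T d \<rho> \<longleftrightarrow> real_tree T d \<and> \<rho> \<in> T"

definition ancestor ::
    "'a set \<Rightarrow> ('a \<Rightarrow> 'a \<Rightarrow> real) \<Rightarrow> 'a \<Rightarrow> 'a \<Rightarrow> 'a \<Rightarrow> bool" where
  "ancestor T d \<rho> x y \<longleftrightarrow> x \<in> segment T d \<rho> y"

definition branch_point ::
    "'a set \<Rightarrow> ('a \<Rightarrow> 'a \<Rightarrow> real) \<Rightarrow> 'a \<Rightarrow> 'a \<Rightarrow> 'a \<Rightarrow> 'a" where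
  "branch_point T d \<rho> x y =
     (THE z. z \<in> T \<and> segment T d \<rho> x \<inter> segment T d \<rho> y = segment T d \<rho> z)"

definition metric_borel :: "'a set \<Rightarrow> ('a \<Rightarrow> 'a \<Rightarrow> real) \<Rightarrow> 'a measure" where
  "metric_borel T d = sigma T {U. openin (Metric_space.mtopology T d) U}"


section \<open>Totally ordered measured trees\<close>

text \<open>\<open>(x, y) \<in> ord c\<close> means \<open>x \<le> y\<close>.\<close>

record 'a tom_structure =
  points :: "'a set"
  distance :: "'a \<Rightarrow> 'a \<Rightarrow> real"
  root :: 'a
  ord :: "('a \<times> 'a) set"
  mass :: "'a measure"

definition TOM_tree :: "'a tom_structure \<Rightarrow> bool" where
  "TOM_tree c \<longleftrightarrow>
     (let T = points c; d = distance c; \<rho> = root c; R = ord c; \<mu> = mass c in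
        rooted_real_tree T d \<rho> \<and>
        linear_order_on T R \<and>
        \<comment> \<open>Or1\<close>
        (\<forall>x\<in>T. \<forall>y\<in>T. ancestor T d \<rho> x y \<longrightarrow> (y, x) \<in> R) \<and>
        \<comment> \<open>Or2\<close>
        (\<forall>x\<in>T. \<forall>y\<in>T. (x, y) \<in> R \<and> x \<noteq> y \<longrightarrow>
           (\<forall>z \<in> segment T d x (branch_point T d \<rho> x y) - {branch_point T d \<rho> x y}.
              (z, y) \<in> R \<and> z \<noteq> y)) \<and>
        sets \<mu> = sets (metric_borel T d) \<and>
        \<comment> \<open>Mes1\<close>
        (\<forall>x\<in>T. \<exists>U. openin (Metric_space.mtopology T d) U \<and> x \<in> U \<and> emeasure \<mu> U < \<infinity>) \<and>
        (\<forall>x\<in>T. \<forall>y\<in>T. (x, y) \<in> R \<and> x \<noteq> y \<longrightarrow>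
           emeasure \<mu> {z\<in>T. (x, z) \<in> R \<and> (z, y) \<in> R} > 0) \<and>
        \<comment> \<open>Mes2\<close>
        (\<forall>x\<in>T. emeasure \<mu> {x} = 0))"

definition compact_TOM_tree :: "'a tom_structure \<Rightarrow> bool" where
  "compact_TOM_tree c \<longleftrightarrow>
     TOM_tree c \<and> compact_space (Metric_space.mtopology (points c) (distance c))"

text \<open>The mass of a compact TOM tree is finite by local finiteness, so nothing is lost by
  using the real-valued \<^const>\<open>measure\<close>.\<close>

definition total_mass :: "'a tom_structure \<Rightarrow> real" where
  "total_mass c = measure (mass c) (points c)"

text \<open>Preservation of the root is not required separately: by Or1 the root of a TOM tree is the
  greatest element of its order.\<close>

definition tom_isomorphic :: "'a tom_structure \<Rightarrow> 'b tom_structure \<Rightarrow> bool" where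
  "tom_isomorphic c c' \<longleftrightarrow>
     (\<exists>h. h ` points c = points c' \<and>
          (\<forall>x\<in>points c. \<forall>y\<in>points c. distance c' (h x) (h y) = distance c x y) \<and>
          (\<forall>x\<in>points c. \<forall>y\<in>points c. (h x, h y) \<in> ord c' \<longleftrightarrow> (x, y) \<in> ord c) \<and>
          distr (mass c) (mass c') h = mass c')"


section \<open>Trees coded by functions\<close>

text \<open>A function \<open>[0,m] \<rightarrow> [0,\<infinity>)\<close> is represented by \<open>f :: real \<Rightarrow> real\<close>, whose values outside
  \<open>{0..m}\<close> are irrelevant.\<close>

definition cadlag_on :: "real \<Rightarrow> (real \<Rightarrow> real) \<Rightarrow> bool" where
  "cadlag_on m f \<longleftrightarrow>
     (\<forall>t\<in>{0..<m}. (f \<longlongrightarrow> f t) (at_right t)) \<and>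
     (\<forall>t\<in>{0<..m}. \<exists>l. (f \<longlongrightarrow> l) (at_left t))"

definition no_negative_jumps_on :: "real \<Rightarrow> (real \<Rightarrow> real) \<Rightarrow> bool" where
  "no_negative_jumps_on m f \<longleftrightarrow>
     (\<forall>t\<in>{0<..m}. \<forall>l. (f \<longlongrightarrow> l) (at_left t) \<longrightarrow> l \<le> f t)"

definition coding_function :: "real \<Rightarrow> (real \<Rightarrow> real) \<Rightarrow> bool" where
  "coding_function m f \<longleftrightarrow>
     cadlag_on m f \<and> no_negative_jumps_on m f \<and> (\<forall>t\<in>{0..m}. 0 \<le> f t) \<and> f m = 0"

definition code_dist :: "(real \<Rightarrow> real) \<Rightarrow> real \<Rightarrow> real \<Rightarrow> real" where
  "code_dist f s t = f s + f t - 2 * (INF u\<in>{min s t..max s t}. f u)"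

definition code_equiv :: "real \<Rightarrow> (real \<Rightarrow> real) \<Rightarrow> (real \<times> real) set" where
  "code_equiv m f = {(s, t). s \<in> {0..m} \<and> t \<in> {0..m} \<and> code_dist f s t = 0}"

text \<open>The induced distance is evaluated on arbitrary representatives; it is set to 0 away from the
  quotient because \<^locale>\<open>Metric_space\<close> demands nonnegativity and symmetry on the whole type.\<close>

definition quotient_dist ::
    "real \<Rightarrow> (real \<Rightarrow> real) \<Rightarrow> real set \<Rightarrow> real set \<Rightarrow> real" where
  "quotient_dist m f A B =
     (if A \<in> {0..m} // code_equiv m f \<and> B \<in> {0..m} // code_equiv m f
      then code_dist f (SOME s. s \<in> A) (SOME t. t \<in> B) else 0)"

definition coded_tree :: "real \<Rightarrow> (real \<Rightarrow> real) \<Rightarrow> real set tom_structure" where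
  "coded_tree m f =
     (let Q = {0..m} // code_equiv m f in
      \<lparr> points = Q,
        distance = quotient_dist m f,
        root = code_equiv m f `` {m},
        ord = {(A, B). A \<in> Q \<and> B \<in> Q \<and> Sup A \<le> Sup B},
        mass = distr (restrict_space lborel {0..m}) (metric_borel Q (quotient_dist m f))
                 (\<lambda>t. code_equiv m f `` {t}) \<rparr>)"

text \<open>\<open>f\<close> is an admissible choice for the function attached to \<open>c\<close>.\<close>

definition codes :: "(real \<Rightarrow> real) \<Rightarrow> 'a tom_structure \<Rightarrow> bool" where
  "codes f c \<longleftrightarrow>
     coding_function (total_mass c) f \<and> tom_isomorphic (coded_tree (total_mass c) f) c"

end

theory Submission
  imports Defs "HOL-Probability.Distribution_Functions"
begin

text \<open>Let \<open>F x\<close> be the mass of \<open>{z. z \<le> x}\<close>. It is injective and order preserving, and since \<open>\<mu>\<close> is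
  diffuse it carries \<open>\<mu>\<close> to Lebesgue measure on \<open>[0, m]\<close>; in particular its range is dense. The set
  of descendants of a point is convex for the order, which together with compactness makes every
  monotone sequence of points converge. Hence \<open>explore t\<close>, the limit of \<open>y\<close> as \<open>F y\<close> decreases to \<open>t\<close>,
  exists and is a left inverse of \<open>F\<close>; the coding function is its distance to the root. The
  infimum of that function over \<open>[s, t]\<close> is the height of the branch point of \<open>explore s\<close> and
  \<open>explore t\<close>, so the coded tree is isometric to the given one, and the largest time at which \<open>x\<close> is
  visited is \<open>F x\<close>, so the orders agree.\<close>

section \<open>Rooted real trees\<close>

text \<open>The function \<open>F\<close> need not be onto \<open>[0, m]\<close>: it misses exactly
  the times at which the exploration is at a point to which it will return later. Limits from the
  right fill these gaps, which is why the coding function comes out cadlag. The obstacle is that Or1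
  and Or2 say nothing about limits. The remedy is separation by a strict ancestor: if x is not an
  ancestor of y, then some strict ancestor c of x is not an ancestor of y either, and descending
  from c holds throughout a neighbourhood of x and fails throughout a neighbourhood of y. In this
  way claims about limits become claims about points of the tree, where two inequalities suffice: by
  Or1 an ancestor has the larger value of \<open>F\<close>, and by Or2 a point outside the
  descendants of c that comes after one of them comes after c itself.\<close>

locale rooted_tree =
  fixes T :: "'a set" and d :: "'a \<Rightarrow> 'a \<Rightarrow> real" and \<rho> :: 'a
  assumes rooted: "rooted_real_tree T d \<rho>"

sublocale rooted_tree \<subseteq> Metric_space T d
  using rooted by (simp add: rooted_real_tree_def real_tree_def)

context rooted_tree
begin

section \<open>Geodesics, segments and ancestors in metric terms\<close>

abbreviation height :: "'a \<Rightarrow> real" where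
  "height x \<equiv> d \<rho> x"

text \<open>The ancestor relation as equality in the triangle inequality (see
  \<open>ancestor_iff\<close>), so that most arguments become linear arithmetic on distances instead
  of reasoning about images of geodesics.\<close>

definition below :: "'a \<Rightarrow> 'a \<Rightarrow> bool" (infix "\<preceq>" 50) where
  "c \<preceq> x \<longleftrightarrow> d \<rho> c + d c x = d \<rho> x"

definition geod :: "'a \<Rightarrow> 'a \<Rightarrow> real \<Rightarrow> 'a" where
  "geod x y = (THE \<phi>. is_geodesic T d x y \<phi>)"

lemma root_in [simp]: "\<rho> \<in> T"
  using rooted by (simp add: rooted_real_tree_def)

lemma ex1_geodesic:
  assumes "x \<in> T" "y \<in> T"
  shows "\<exists>!\<phi>. is_geodesic T d x y \<phi>"
  using rooted assms by (simp add: rooted_real_tree_def real_tree_def)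

lemma is_geodesic_geod:
  assumes "x \<in> T" "y \<in> T"
  shows "is_geodesic T d x y (geod x y)"
  unfolding geod_def using ex1_geodesic[OF assms] by (rule theI')

lemma geod_unique:
  assumes "x \<in> T" "y \<in> T" "is_geodesic T d x y \<phi>"
  shows "\<phi> = geod x y"
  using ex1_geodesic[OF assms(1,2)] is_geodesic_geod[OF assms(1,2)] assms(3) by blast

lemma segment_geod: "segment T d x y = geod x y ` {0..d x y}"
  by (simp add: segment_def geod_def)

lemma arc_image:
  assumes "x \<in> T" "y \<in> T" "continuous_map (top_of_set {0..1}) mtopology \<phi>"
    "inj_on \<phi> {0..1::real}" "\<phi> 0 = x" "\<phi> 1 = y"
  shows "\<phi> ` {0..1} = segment T d x y"
proof -
  have "\<forall>x\<in>T. \<forall>y\<in>T. \<forall>\<phi>.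
        continuous_map (top_of_set {0..1}) (Metric_space.mtopology T d) \<phi> \<and>
        inj_on \<phi> {0..1::real} \<and> \<phi> 0 = x \<and> \<phi> 1 = y
        \<longrightarrow> \<phi> ` {0..1} = segment T d x y"
    using rooted unfolding rooted_real_tree_def real_tree_def by blast
  then show ?thesis using assms by blast
qed

lemma geod_in:
  assumes "x \<in> T" "y \<in> T" "s \<in> {0..d x y}"
  shows "geod x y s \<in> T"
  using is_geodesic_geod[OF assms(1,2)] assms(3) unfolding is_geodesic_def by (auto dest: PiE_mem)

lemma geod_dist:
  assumes "x \<in> T" "y \<in> T" "s \<in> {0..d x y}" "t \<in> {0..d x y}"
  shows "d (geod x y s) (geod x y t) = \<bar>s - t\<bar>"
  using is_geodesic_geod[OF assms(1,2)] assms(3,4) unfolding is_geodesic_def by blast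

lemma geod_ends:
  assumes "x \<in> T" "y \<in> T"
  shows "geod x y 0 = x" "geod x y (d x y) = y"
  using is_geodesic_geod[OF assms(1,2)] unfolding is_geodesic_def by blast+

lemma geod_dist_ends:
  assumes "x \<in> T" "y \<in> T" "s \<in> {0..d x y}"
  shows "d x (geod x y s) = s" "d (geod x y s) y = d x y - s"
  using geod_dist[OF assms(1,2), of 0 s] geod_dist[OF assms(1,2), of s "d x y"]
    geod_ends[OF assms(1,2)] assms(3) by auto

text \<open>A point between \<open>x\<close> and \<open>y\<close> lies on the geodesic, because concatenating the geodesics
  through it gives a geodesic and geodesics are unique.\<close>

lemma between_eq_geod:
  assumes "x \<in> T" "y \<in> T" "z \<in> T" "d x z + d z y = d x y"
  shows "geod x y (d x z) = z"
proof -
  define D where "D = d x y"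
  define a where "a = d x z"
  have a: "0 \<le> a" "a \<le> D" "0 \<le> D" "d z y = D - a"
    using assms(4) nonneg[of z y] nonneg[of x z] by (auto simp: a_def D_def simp del: nonneg)
  \<comment> \<open>Off the interval the value must be \<open>undefined\<close>, because
    \<open>is_geodesic\<close> asks for an extensional function.\<close>
  define \<phi> where "\<phi> s = (if s \<in> {0..D} then (if s \<le> a then geod x z s else geod z y (s - a))
      else undefined)" for s
  have in1: "\<phi> s \<in> T" if "s \<in> {0..D}" for s
    using that a geod_in[OF assms(1,3), of s] geod_in[OF assms(3,2), of "s - a"]
    by (auto simp: \<phi>_def a_def)
  have dz: "d (\<phi> s) z = \<bar>s - a\<bar>" "d x (\<phi> s) \<le> s" "d (\<phi> s) y \<le> D - s" if s: "s \<in> {0..D}" for s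
  proof -
    have "d (\<phi> s) z = \<bar>s - a\<bar> \<and> d x (\<phi> s) \<le> s \<and> d (\<phi> s) y \<le> D - s"
    proof (cases "s \<le> a")
      case True
      then have "s \<in> {0..d x z}" using s by (auto simp: a_def)
      note g = geod_in[OF assms(1,3) this] geod_dist_ends[OF assms(1,3) this]
      show ?thesis using g True s a triangle[of "geod x z s" z y] assms
        by (auto simp: \<phi>_def a_def)
    next
      case False
      then have "s - a \<in> {0..d z y}" using s a by auto
      note g = geod_in[OF assms(3,2) this] geod_dist_ends[OF assms(3,2) this]
      show ?thesis using g False s a triangle[of x z "geod z y (s - a)"] assms
        by (auto simp: \<phi>_def a_def commute)
    qed
    then show "d (\<phi> s) z = \<bar>s - a\<bar>" "d x (\<phi> s) \<le> s" "d (\<phi> s) y \<le> D - s" by auto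
  qed
  have same: "d (\<phi> s) (\<phi> t) = \<bar>s - t\<bar>" if st: "s \<in> {0..D}" "t \<in> {0..D}" "s \<le> t" for s t
  proof -
    \<comment> \<open>The path from x through both points to y has length at least D, and the two
      outer pieces use up at most s and D - t.\<close>
    have low: "t - s \<le> d (\<phi> s) (\<phi> t)"
      using dz[OF st(1)] dz[OF st(2)] triangle[of x "\<phi> s" "\<phi> t"] triangle[of x "\<phi> t" y]
        in1[OF st(1)] in1[OF st(2)] assms by (auto simp: D_def)
    have up: "d (\<phi> s) (\<phi> t) \<le> t - s"
    proof -
      consider "t \<le> a" | "s \<le> a" "a < t" | "a < s" using st by linarith
      then show ?thesis
      proof cases
        case 1 then show ?thesis
          using st geod_dist[OF assms(1,3), of s t] by (auto simp: \<phi>_def a_def)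
      next
        case 2 then show ?thesis
          using dz[OF st(1)] dz[OF st(2)] triangle[of "\<phi> s" z "\<phi> t"]
            in1[OF st(1)] in1[OF st(2)] assms by (auto simp: commute)
      next
        case 3 then show ?thesis
          using st a geod_dist[OF assms(3,2), of "s - a" "t - a"] by (auto simp: \<phi>_def)
      qed
    qed
    show ?thesis using low up st by auto
  qed
  have "is_geodesic T d x y \<phi>"
    unfolding is_geodesic_def
  proof (intro conjI ballI)
    show "\<phi> \<in> {0..d x y} \<rightarrow>\<^sub>E T" using in1 by (auto simp: PiE_iff D_def \<phi>_def extensional_def)
    show "d (\<phi> s) (\<phi> t) = \<bar>s - t\<bar>" if "s \<in> {0..d x y}" "t \<in> {0..d x y}" for s t
      using same[of s t] same[of t s] that unfolding D_def[symmetric]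
      by (cases "s \<le> t") (auto simp: commute)
    show "\<phi> 0 = x" using a geod_ends[OF assms(1,3)] by (auto simp: \<phi>_def a_def)
    have "d (\<phi> D) y \<le> 0" using dz(3)[of D] a by auto
    then have "d (\<phi> D) y = 0" using nonneg[of "\<phi> D" y] by linarith
    then show "\<phi> (d x y) = y" using in1[of D] a assms by (simp add: D_def)
  qed
  then have "\<phi> = geod x y" by (rule geod_unique[OF assms(1,2)])
  moreover have "\<phi> a = z" using a geod_ends[OF assms(1,3)] by (auto simp: \<phi>_def a_def)
  ultimately show ?thesis by (simp add: a_def)
qed

lemma segment_iff:
  assumes "x \<in> T" "y \<in> T"
  shows "z \<in> segment T d x y \<longleftrightarrow> z \<in> T \<and> d x z + d z y = d x y"
proof
  assume "z \<in> segment T d x y"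
  then obtain s where "s \<in> {0..d x y}" "z = geod x y s" by (auto simp: segment_geod)
  then show "z \<in> T \<and> d x z + d z y = d x y"
    using geod_in[OF assms] geod_dist_ends[OF assms] by auto
next
  assume z: "z \<in> T \<and> d x z + d z y = d x y"
  then have "z = geod x y (d x z)" "d x z \<in> {0..d x y}"
    using between_eq_geod[OF assms, of z] nonneg[of z y] nonneg[of x z] by (auto simp del: nonneg)
  then show "z \<in> segment T d x y" by (auto simp: segment_geod)
qed

lemma ancestor_iff: "y \<in> T \<Longrightarrow> ancestor T d \<rho> x y \<longleftrightarrow> x \<in> T \<and> x \<preceq> y"
  by (simp add: ancestor_def segment_iff below_def)

lemma below_height: "c \<preceq> x \<Longrightarrow> height c \<le> height x"
  unfolding below_def using nonneg[of c x] by linarith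

lemma below_refl [simp]: "x \<in> T \<Longrightarrow> x \<preceq> x"
  by (simp add: below_def)

lemma root_below [simp]: "x \<in> T \<Longrightarrow> \<rho> \<preceq> x"
  by (simp add: below_def)

lemma below_trans:
  assumes "a \<preceq> b" "b \<preceq> c" "a \<in> T" "b \<in> T" "c \<in> T"
  shows "a \<preceq> c"
  using assms triangle[of a b c] triangle[of \<rho> a c] by (auto simp: below_def)

lemma below_geod: "c \<in> T \<Longrightarrow> x \<in> T \<Longrightarrow> c \<preceq> x \<Longrightarrow> geod \<rho> x (height c) = c"
  by (simp add: below_def between_eq_geod)

lemma geod_below:
  assumes "x \<in> T" "0 \<le> h" "h \<le> height x"
  shows "geod \<rho> x h \<in> T" "geod \<rho> x h \<preceq> x" "height (geod \<rho> x h) = h"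
  using geod_in[of \<rho> x h] geod_dist_ends[of \<rho> x h] assms by (auto simp: below_def)

lemma obtain_height:
  assumes "x \<in> T" "0 \<le> h" "h \<le> height x"
  obtains c where "c \<in> T" "c \<preceq> x" "height c = h"
  using geod_below[OF assms] by blast

text \<open>All ancestors of x lie on the single geodesic from the root to x, where distance is
  difference of heights.\<close>

lemma below_comparable:
  assumes "c \<in> T" "e \<in> T" "x \<in> T" "c \<preceq> x" "e \<preceq> x" "height c \<le> height e"
  shows "c \<preceq> e"
proof -
  have "d c e = \<bar>height c - height e\<bar>"
    using geod_dist[of \<rho> x "height c" "height e"] below_geod[of c x] below_geod[of e x]
      below_height[of c x] below_height[of e x] assms by simp
  then show ?thesis using assms by (simp add: below_def)
qed

lemma below_antisym:
  assumes "c \<in> T" "e \<in> T" "c \<preceq> e" "height e \<le> height c"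
  shows "c = e"
  using assms nonneg[of c e] zero[of c e] unfolding below_def by linarith

section \<open>Branch points\<close>

text \<open>The greatest common ancestor lies between \<open>x\<close> and \<open>y\<close>: otherwise the path descending to it
  from \<open>x\<close> and climbing up to \<open>y\<close> would be an injective path missing the geodesic.\<close>

lemma meet_exists:
  assumes x: "x \<in> T" and y: "y \<in> T"
  obtains e where "e \<in> T" "e \<preceq> x" "e \<preceq> y" "d x y = d e x + d e y"
    "\<And>c. c \<in> T \<Longrightarrow> c \<preceq> x \<Longrightarrow> c \<preceq> y \<Longrightarrow> height c \<le> height e"
proof -
  define X where "X = geod \<rho> x"
  define Y where "Y = geod \<rho> y"
  define M where "M = min (height x) (height y)"
  define S where "S = {s \<in> {0..M}. X s = Y s}"
  have XY: "X s \<in> T" "Y s \<in> T" "X s \<preceq> x" "Y s \<preceq> y" "height (X s) = s" "height (Y s) = s"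
    if "s \<in> {0..M}" for s
    using geod_below[OF x] geod_below[OF y] that by (auto simp: X_def Y_def M_def)
  have S0: "0 \<in> S" using geod_ends x y by (auto simp: S_def X_def Y_def M_def)
  have Sb: "bdd_above S" by (rule bdd_aboveI[of _ M]) (auto simp: S_def)
  define h where "h = Sup S"
  have hub: "s \<le> h" if "s \<in> S" for s using that Sb by (auto simp: h_def intro: cSup_upper)
  have hM: "h \<in> {0..M}"
    using hub[OF S0] cSup_least[of S M] S0 unfolding h_def S_def
    by (metis (no_types, lifting) atLeastAtMost_iff empty_iff mem_Collect_eq)
  \<comment> \<open>The supremum h is attained: the geodesics agree at heights arbitrarily close to
    h and both move at unit speed.\<close>
  have "d (X h) (Y h) \<le> 2 * \<epsilon>" if eps: "\<epsilon> > 0" for \<epsilon>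
  proof -
    have "h - \<epsilon> < Sup S" "S \<noteq> {}" using S0 eps by (auto simp: h_def)
    then obtain s where s: "s \<in> S" "h - \<epsilon> < s" by (rule less_cSupE)
    have "s \<le> h" using hub s by auto
    have sM: "s \<in> {0..M}" "X s = Y s" using s by (auto simp: S_def)
    have "d (X h) (X s) = \<bar>h - s\<bar>" "d (Y s) (Y h) = \<bar>s - h\<bar>"
      using geod_dist[of \<rho> x h s] geod_dist[of \<rho> y s h] x y hM sM by (auto simp: X_def Y_def M_def)
    moreover have "d (X h) (Y h) \<le> d (X h) (X s) + d (X s) (Y h)"
      using triangle XY(1,2)[OF hM] XY(1)[OF sM(1)] by blast
    ultimately show ?thesis using sM(2) s(2) \<open>s \<le> h\<close> by simp
  qed
  \<comment> \<open>For a positive distance this bound would make it at most half of itself.\<close>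
  from this[of "d (X h) (Y h) / 4"] have "d (X h) (Y h) = 0"
    using nonneg[of "X h" "Y h"] by linarith
  then have XYh: "X h = Y h" using XY[OF hM] by simp
  define e where "e = X h"
  have e: "e \<in> T" "e \<preceq> x" "e \<preceq> y" "height e = h" using XY[OF hM] XYh by (auto simp: e_def)
  have great: "height c \<le> height e" if "c \<in> T" "c \<preceq> x" "c \<preceq> y" for c
  proof -
    have "height c \<in> S"
      using that below_geod x y below_height by (auto simp: S_def X_def Y_def M_def)
    then show ?thesis using hub e by auto
  qed
  have dex: "d e x = height x - h" "d e y = height y - h" using e by (auto simp: below_def)
  have "d x y = d e x + d e y"
  proof (cases "e = x \<or> e = y")
    case True then show ?thesis using x y by (auto simp: commute)
  next
    case False
    define A where "A = d e x"
    define B where "B = d e y"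
    have AB: "A > 0" "B > 0" using False e x y by (auto simp: A_def B_def mdist_pos_less)
    have hAB: "height x = h + A" "height y = h + B" "0 \<le> h"
      using dex hM by (auto simp: A_def B_def)
    \<comment> \<open>The walk from x down to e and up to y, parametrised by length, so that e is
      reached at v = A. The map p rescales it to the unit interval demanded by
      \<open>arc_image\<close>.\<close>
    define q where "q v = (if v \<le> A then X (h + A - v) else Y (h + v - A))" for v
    define p where "p u = q (u * (A + B))" for u
    have dX: "d (X s) (X t) = \<bar>s - t\<bar>" if "s \<in> {0..h+A}" "t \<in> {0..h+A}" for s t
      using geod_dist[of \<rho> x s t] that x hAB by (auto simp: X_def)
    have dY: "d (Y s) (Y t) = \<bar>s - t\<bar>" if "s \<in> {0..h+B}" "t \<in> {0..h+B}" for s t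
      using geod_dist[of \<rho> y s t] that y hAB by (auto simp: Y_def)
    have XT: "X s \<in> T" if "s \<in> {0..h+A}" for s
      using geod_in[of \<rho> x s] that x hAB by (auto simp: X_def)
    have YT: "Y s \<in> T" if "s \<in> {0..h+B}" for s
      using geod_in[of \<rho> y s] that y hAB by (auto simp: Y_def)
    have qT: "q v \<in> T" if "v \<in> {0..A+B}" for v
      using that XT[of "h + A - v"] YT[of "h + v - A"] hAB by (auto simp: q_def)
    have lip: "d (q v) (q w) \<le> w - v" if vw: "v \<in> {0..A+B}" "w \<in> {0..A+B}" "v \<le> w" for v w
    proof -
      consider "w \<le> A" | "v \<le> A" "A < w" | "A < v" using vw by linarith
      then show ?thesis
      proof cases
        case 1 then show ?thesis using vw dX[of "h+A-v" "h+A-w"] hAB by (auto simp: q_def)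
      next
        case 2
        have "d (X (h+A-v)) (X h) = A - v" "d (Y h) (Y (h+w-A)) = w - A"
          using vw 2 dX[of "h+A-v" "h"] dY[of h "h+w-A"] hAB AB by auto
        then show ?thesis
          using 2 triangle[of "q v" e "q w"] qT[of v] qT[of w] vw e(1) XYh by (auto simp: q_def e_def)
      next
        case 3 then show ?thesis using vw dY[of "h+v-A" "h+w-A"] hAB by (auto simp: q_def)
      qed
    qed
    have inj: "q v \<noteq> q w" if vw: "v \<in> {0..A+B}" "w \<in> {0..A+B}" "v < w" for v w
    proof
      assume eq: "q v = q w"
      consider "w \<le> A" | "v \<le> A" "A < w" | "A < v" using vw by linarith
      then show False
      proof cases
        case 1 then show ?thesis using vw dX[of "h+A-v" "h+A-w"] XT[of "h+A-w"] hAB eq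
          by (auto simp: q_def)
      next
        case 2
        \<comment> \<open>Equal points have equal heights, so the two branches would meet again at a
          height above h, against the choice of h as supremum of S.\<close>
        have 3: "X (h+A-v) = Y (h+w-A)" using 2 eq by (auto simp: q_def)
        have "height (X (h+A-v)) = h+A-v" "height (Y (h+w-A)) = h+w-A"
          using geod_below(3)[OF x, of "h+A-v"] geod_below(3)[OF y, of "h+w-A"] 2 vw hAB
          by (auto simp: X_def Y_def)
        then have *: "h+A-v = h+w-A" using 3 by simp
        have "X (h+w-A) = Y (h+w-A)" using 3 unfolding * .
        then have "h+w-A \<in> S" using * 2 vw hAB by (auto simp: S_def M_def)
        then show ?thesis using hub 2 by fastforce
      next
        case 3 then show ?thesis using vw dY[of "h+v-A" "h+w-A"] YT[of "h+w-A"] hAB eq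
          by (auto simp: q_def)
      qed
    qed
    have scale: "u * (A + B) \<in> {0..A+B}" if "u \<in> {0..1}" for u
      using that AB by (auto simp: mult_left_le_one_le)
    have "inj_on p {0..1}"
    proof (rule linorder_inj_onI)
      fix u v :: real assume "u < v" "u \<in> {0..1}" "v \<in> {0..1}"
      then show "p u \<noteq> p v"
        using inj[OF scale scale, of u v] AB by (auto simp: p_def)
    qed auto
    moreover have "continuous_map (top_of_set {0..1}) mtopology p"
      unfolding continuous_map_to_metric
    proof (intro ballI allI impI)
      fix u \<epsilon> :: real assume u: "u \<in> topspace (top_of_set {0..1})" and "\<epsilon> > 0"
      define \<delta> where "\<delta> = \<epsilon> / (A + B)"
      have "\<delta> > 0" using AB \<open>\<epsilon> > 0\<close> by (auto simp: \<delta>_def)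
      have "p v \<in> mball (p u) \<epsilon>" if "v \<in> {0..1} \<inter> ball u \<delta>" for v
      proof -
        have "d (p u) (p v) \<le> \<bar>u * (A+B) - v * (A+B)\<bar>"
          using lip[OF scale scale, of u v] lip[OF scale scale, of v u] u that
          by (cases "u * (A+B) \<le> v * (A+B)") (auto simp: p_def commute)
        also have "\<dots> = \<bar>u - v\<bar> * (A + B)" using AB by (simp add: abs_mult flip: left_diff_distrib)
        also have "\<dots> < \<delta> * (A + B)" using that AB by (auto simp: dist_real_def)
        also have "\<dots> = \<epsilon>" using AB by (simp add: \<delta>_def)
        finally show ?thesis using qT scale u that by (auto simp: p_def)
      qed
      then show "\<exists>U. openin (top_of_set {0..1}) U \<and> u \<in> U \<and> (\<forall>v\<in>U. p v \<in> mball (p u) \<epsilon>)"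
        using u \<open>\<delta> > 0\<close> by (intro exI[of _ "{0..1} \<inter> ball u \<delta>"]) (auto intro: openin_open_Int)
    qed
    moreover have "p 0 = x" "p 1 = y"
      using AB hAB geod_ends[of \<rho> x] geod_ends[of \<rho> y] x y
      by (auto simp: p_def q_def X_def Y_def)
    ultimately have "p ` {0..1} = segment T d x y" using arc_image x y by blast
    moreover have "p (A / (A + B)) = e" "A / (A + B) \<in> {0..1}"
      using AB by (auto simp: p_def q_def e_def)
    ultimately have "e \<in> segment T d x y" by blast
    then show ?thesis using segment_iff[OF x y] by (auto simp: commute)
  qed
  then show ?thesis using that e great by blast
qed

text \<open>Hence the strict descendants of \<open>c\<close> are interior to the set of its descendants.\<close>

lemma dist_le_if_separated:
  assumes "c \<in> T" "a \<in> T" "x \<in> T" "c \<preceq> a" "\<not> c \<preceq> x"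
  shows "d c a \<le> d a x"
proof -
  obtain e where e: "e \<in> T" "e \<preceq> a" "e \<preceq> x" "d a x = d e a + d e x"
    using meet_exists[of a x] assms by metis
  have "height e < height c"
    using below_comparable[of c e a] below_trans[of c e x] e assms by force
  moreover have "d c a = height a - height c" "d e a = height a - height e"
    using e assms by (simp_all add: below_def)
  ultimately show ?thesis using e nonneg[of e x] by linarith
qed

text \<open>Ancestors of a point form a chain, so the common ancestors of x and y are exactly the
  ancestors of the highest one.\<close>

lemma branch_point_eq:
  assumes "x \<in> T" "y \<in> T" "e \<in> T" "e \<preceq> x" "e \<preceq> y"
    and great: "\<And>c. c \<in> T \<Longrightarrow> c \<preceq> x \<Longrightarrow> c \<preceq> y \<Longrightarrow> height c \<le> height e"
  shows "branch_point T d \<rho> x y = e"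
  unfolding branch_point_def
proof (rule the_equality)
  show "e \<in> T \<and> segment T d \<rho> x \<inter> segment T d \<rho> y = segment T d \<rho> e"
  proof (intro conjI set_eqI)
    fix c
    have "c \<preceq> x \<and> c \<preceq> y \<longleftrightarrow> c \<preceq> e" if "c \<in> T"
      using below_comparable[of c e x] below_trans[of c e x] below_trans[of c e y] great[of c]
        that assms(1-5) by blast
    then show "c \<in> segment T d \<rho> x \<inter> segment T d \<rho> y \<longleftrightarrow> c \<in> segment T d \<rho> e"
      using assms(1-3) by (auto simp: segment_iff simp flip: below_def)
  qed (fact assms(3))
next
  fix z assume z: "z \<in> T \<and> segment T d \<rho> x \<inter> segment T d \<rho> y = segment T d \<rho> z"
  have "z \<in> segment T d \<rho> z" using z by (simp add: segment_iff)
  then have "z \<in> segment T d \<rho> x \<inter> segment T d \<rho> y" using z by simp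
  then have "height z \<le> height e" using great assms(1,2) by (simp add: segment_iff below_def)
  moreover have "e \<in> segment T d \<rho> x \<inter> segment T d \<rho> y"
    using assms(1-5) by (simp add: segment_iff below_def)
  then have "e \<in> segment T d \<rho> z" using z by simp
  then have "e \<preceq> z" using z by (simp add: segment_iff below_def)
  ultimately show "z = e" using below_antisym[of e z] z assms by auto
qed

text \<open>Places c in the half-open segment over which Or2 quantifies; this is how Or2 becomes the
  assumption \<open>F_separated\<close> below.\<close>

lemma in_segment_branch_point:
  assumes "c \<in> T" "x \<in> T" "y \<in> T" "c \<preceq> x" "\<not> c \<preceq> y"
  shows "c \<in> segment T d x (branch_point T d \<rho> x y) - {branch_point T d \<rho> x y}"
proof -
  obtain e where e: "e \<in> T" "e \<preceq> x" "e \<preceq> y"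
    "\<And>c. c \<in> T \<Longrightarrow> c \<preceq> x \<Longrightarrow> c \<preceq> y \<Longrightarrow> height c \<le> height e"
    using meet_exists[of x y] assms by metis
  have h: "height e < height c"
    using below_comparable[of c e x] below_trans[of c e y] e assms by force
  have "e \<preceq> c" using below_comparable[of e c x] h e assms by auto
  then have "d x c + d c e = d x e" using e assms by (simp add: below_def commute)
  then show ?thesis using branch_point_eq[OF assms(2,3) e] h e assms by (auto simp: segment_iff)
qed

end


section \<open>The exploration of an ordered tree\<close>

text \<open>\<open>F x\<close> stands for the mass of \<open>{z. z \<le> x}\<close>, which encodes the order of the tree.\<close>

locale explored_tree = rooted_tree +
  fixes F :: "'a \<Rightarrow> real" and m :: real
  assumes compact: "compact_space mtopology"
    and F_nonneg: "\<And>x. x \<in> T \<Longrightarrow> 0 \<le> F x"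
    and F_le: "\<And>x. x \<in> T \<Longrightarrow> F x \<le> m"
    and F_inj: "inj_on F T"
    and F_root: "F \<rho> = m"
    and F_below: "\<And>c x. c \<in> T \<Longrightarrow> x \<in> T \<Longrightarrow> c \<preceq> x \<Longrightarrow> F x \<le> F c"
    and F_separated: "\<And>c x y. c \<in> T \<Longrightarrow> x \<in> T \<Longrightarrow> y \<in> T \<Longrightarrow> c \<preceq> x \<Longrightarrow> \<not> c \<preceq> y
      \<Longrightarrow> F x < F y \<Longrightarrow> F c < F y"
    and F_dense: "\<And>s t. 0 \<le> s \<Longrightarrow> s < t \<Longrightarrow> t \<le> m \<Longrightarrow> \<exists>y\<in>T. s < F y \<and> F y < t"
begin

section \<open>Convexity of subtrees and separation of points\<close>

lemma F_eq_iff: "x \<in> T \<Longrightarrow> y \<in> T \<Longrightarrow> F x = F y \<longleftrightarrow> x = y"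
  using F_inj by (auto dest: inj_onD)

lemma m_nonneg: "0 \<le> m"
  using F_nonneg[of \<rho>] F_root by simp

text \<open>If c were not an ancestor of y, separation from x would give \<open>F c < F y\<close>,
  whereas \<open>F y < F z\<close> and \<open>F z \<le> F c\<close>.\<close>

lemma subtree_convex:
  assumes "c \<in> T" "x \<in> T" "y \<in> T" "z \<in> T" "c \<preceq> x" "c \<preceq> z" "F x < F y" "F y < F z"
  shows "c \<preceq> y"
  using F_separated[of c x y] F_below[of c z] assms by force

text \<open>The ancestors of x strictly above the branch point with y. A whole interval of heights
  is kept because \<open>left_limit_below\<close> needs two such points.\<close>

lemma obtain_separator:
  assumes "x \<in> T" "y \<in> T" "\<not> x \<preceq> y"
  obtains h0 where "h0 < height x"
    "\<And>h. h0 < h \<Longrightarrow> h < height x \<Longrightarrow> \<exists>c\<in>T. c \<preceq> x \<and> c \<noteq> x \<and> \<not> c \<preceq> y \<and> height c = h"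
proof -
  obtain e where e: "e \<in> T" "e \<preceq> x" "e \<preceq> y"
    "\<And>c. c \<in> T \<Longrightarrow> c \<preceq> x \<Longrightarrow> c \<preceq> y \<Longrightarrow> height c \<le> height e"
    using meet_exists[OF assms(1,2)] by metis
  have "height e < height x"
    using below_antisym[of e x] below_height[of e x] e assms by force
  moreover have "\<exists>c\<in>T. c \<preceq> x \<and> c \<noteq> x \<and> \<not> c \<preceq> y \<and> height c = h"
    if h: "height e < h" "h < height x" for h
  proof -
    have "0 \<le> h" using h nonneg[of \<rho> e] by linarith
    then obtain c where c: "c \<in> T" "c \<preceq> x" "height c = h"
      using obtain_height[of x h] assms h by (metis less_imp_le)
    then show ?thesis using e(4)[of c] h by auto
  qed
  ultimately show ?thesis using that by blast
qed

text \<open>The separating ancestor has to differ from x: only then does \<open>below_nbhd\<close>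
  extend descent from c to a neighbourhood of x.\<close>

lemma separator:
  assumes "x \<in> T" "y \<in> T" "\<not> x \<preceq> y"
  obtains c where "c \<in> T" "c \<preceq> x" "c \<noteq> x" "\<not> c \<preceq> y"
proof -
  obtain h0 where h: "h0 < height x"
    "\<And>h. h0 < h \<Longrightarrow> h < height x \<Longrightarrow> \<exists>c\<in>T. c \<preceq> x \<and> c \<noteq> x \<and> \<not> c \<preceq> y \<and> height c = h"
    using obtain_separator[OF assms] by metis
  obtain k where "h0 < k" "k < height x" using dense[OF h(1)] by blast
  then show ?thesis using h(2) that by blast
qed

lemma below_nbhd:
  assumes "c \<in> T" "a \<in> T" "c \<preceq> a" "c \<noteq> a"
  obtains \<epsilon> where "\<epsilon> > 0" "\<And>x. x \<in> T \<Longrightarrow> d a x < \<epsilon> \<Longrightarrow> c \<preceq> x"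
  using that[of "d c a"] dist_le_if_separated[of c a] assms by force

lemma not_below_nbhd:
  assumes "c \<in> T" "b \<in> T" "\<not> c \<preceq> b"
  obtains \<epsilon> where "\<epsilon> > 0" "\<And>x. x \<in> T \<Longrightarrow> d b x < \<epsilon> \<Longrightarrow> \<not> c \<preceq> x"
proof -
  \<comment> \<open>The defect in the triangle inequality changes by at most twice the distance
    moved, hence the radius \<open>\<eta> / 2\<close>.\<close>
  define \<eta> where "\<eta> = d \<rho> c + d c b - d \<rho> b"
  have "\<eta> \<ge> 0" using triangle[of \<rho> c b] assms by (simp add: \<eta>_def)
  moreover have "\<eta> \<noteq> 0" using assms by (auto simp: \<eta>_def below_def)
  ultimately have "\<eta> / 2 > 0" by simp
  moreover have "\<not> c \<preceq> x" if "x \<in> T" "d b x < \<eta> / 2" for x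
    using that assms triangle[of c x b] triangle[of \<rho> b x]
    by (auto simp: \<eta>_def below_def commute)
  ultimately show ?thesis using that by blast
qed

section \<open>Limits along the order\<close>

text \<open>The limit of y as \<open>g y\<close> decreases to 0. Taking \<open>F y - t\<close> or
  \<open>t - F y\<close> for g gives limits from the right or from the left of t, so one existence
  proof serves both.\<close>

definition near :: "('a \<Rightarrow> real) \<Rightarrow> 'a \<Rightarrow> bool" where
  "near g a \<longleftrightarrow> a \<in> T \<and> (\<forall>\<epsilon>>0. \<exists>\<delta>>0. \<forall>y\<in>T. 0 < g y \<and> g y < \<delta> \<longrightarrow> d a y < \<epsilon>)"

text \<open>Sequential compactness along points with \<open>g y\<close> below 1/(n+1). The predicate
  P lets \<open>near_exists\<close> ask for a second cluster point among the points that stay away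
  from the first.\<close>

lemma cluster_point_exists:
  fixes g :: "'a \<Rightarrow> real"
  assumes "\<And>\<delta>. \<delta> > 0 \<Longrightarrow> \<exists>y\<in>T. 0 < g y \<and> g y < \<delta> \<and> P y"
  shows "\<exists>a\<in>T. \<forall>\<epsilon>>0. \<forall>\<delta>>0. \<exists>y\<in>T. 0 < g y \<and> g y < \<delta> \<and> P y \<and> d a y < \<epsilon>"
proof -
  have "\<exists>y\<in>T. 0 < g y \<and> g y < inverse (real (Suc n)) \<and> P y" for n
    using assms[of "inverse (real (Suc n))"] by simp
  then obtain y where y: "\<And>n. y n \<in> T" "\<And>n. 0 < g (y n)" "\<And>n. P (y n)"
    "\<And>n. g (y n) < inverse (real (Suc n))" by metis
  have "compactin mtopology T" using compact by (simp add: compact_space_def)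
  moreover have "range y \<subseteq> T" using y by auto
  ultimately obtain a r where a: "a \<in> T" and r: "strict_mono r"
    and l: "limitin mtopology (y \<circ> r) a sequentially"
    unfolding compactin_sequentially by blast
  have lim: "(\<lambda>n. d (y (r n)) a) \<longlonglongrightarrow> 0" using l by (simp add: limitin_metric_dist_null o_def)
  have "\<exists>y\<in>T. 0 < g y \<and> g y < \<delta> \<and> P y \<and> d a y < \<epsilon>" if "\<epsilon> > 0" "\<delta> > 0" for \<epsilon> \<delta>
  proof -
    have "eventually (\<lambda>n. inverse (real (Suc n)) < \<delta>) sequentially"
      using that LIMSEQ_inverse_real_of_nat by (intro order_tendstoD) auto
    moreover have "eventually (\<lambda>n. d (y (r n)) a < \<epsilon>) sequentially"
      using that lim by (intro order_tendstoD) auto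
    ultimately have "eventually (\<lambda>n. inverse (real (Suc n)) < \<delta> \<and> d (y (r n)) a < \<epsilon>) sequentially"
      by eventually_elim simp
    then obtain n where n: "inverse (real (Suc n)) < \<delta>" "d (y (r n)) a < \<epsilon>"
      by (auto simp: eventually_sequentially)
    have "inverse (real (Suc (r n))) \<le> inverse (real (Suc n))"
      using seq_suble[OF r, of n] by (intro le_imp_inverse_le) auto
    then have "g (y (r n)) < \<delta>" using y(4)[of "r n"] n by linarith
    then show ?thesis using y[of "r n"] n by (auto simp: commute)
  qed
  then show ?thesis using a by blast
qed

text \<open>Convexity of the sets of descendants forbids to come close alternately to two distinct
  points while progressing monotonically through the order.\<close>

lemma near_exists:
  assumes ex: "\<And>\<delta>. \<delta> > 0 \<Longrightarrow> \<exists>y\<in>T. 0 < g y \<and> g y < \<delta>"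
    and convex: "\<And>c x y z. c \<in> T \<Longrightarrow> x \<in> T \<Longrightarrow> y \<in> T \<Longrightarrow> z \<in> T \<Longrightarrow> c \<preceq> x \<Longrightarrow> c \<preceq> z
      \<Longrightarrow> g x < g y \<Longrightarrow> g y < g z \<Longrightarrow> c \<preceq> y"
  shows "\<exists>a. near g a"
proof -
  have below: "a \<preceq> b" if "a \<in> T" "b \<in> T"
    and a: "\<And>\<epsilon> \<delta>. \<epsilon> > 0 \<Longrightarrow> \<delta> > (0::real) \<Longrightarrow> \<exists>y\<in>T. 0 < g y \<and> g y < \<delta> \<and> d a y < \<epsilon>"
    and b: "\<And>\<epsilon> \<delta>. \<epsilon> > 0 \<Longrightarrow> \<delta> > (0::real) \<Longrightarrow> \<exists>y\<in>T. 0 < g y \<and> g y < \<delta> \<and> d b y < \<epsilon>"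
  for a b
  proof (rule ccontr)
    assume "\<not> a \<preceq> b"
    then obtain c where c: "c \<in> T" "c \<preceq> a" "c \<noteq> a" "\<not> c \<preceq> b"
      using separator \<open>a \<in> T\<close> \<open>b \<in> T\<close> by blast
    obtain \<epsilon> where \<epsilon>: "\<epsilon> > 0" "\<And>x. x \<in> T \<Longrightarrow> d a x < \<epsilon> \<Longrightarrow> c \<preceq> x"
      using below_nbhd c \<open>a \<in> T\<close> by metis
    obtain \<epsilon>' where \<epsilon>': "\<epsilon>' > 0" "\<And>x. x \<in> T \<Longrightarrow> d b x < \<epsilon>' \<Longrightarrow> \<not> c \<preceq> x"
      using not_below_nbhd c \<open>b \<in> T\<close> by metis
    \<comment> \<open>The values of g decrease from u to v to w, while these points lie near a, b
      and a in turn; convexity then forces v to descend from c.\<close>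
    obtain u where u: "u \<in> T" "0 < g u" "d a u < \<epsilon>" using a[of \<epsilon> 1] \<epsilon> by auto
    obtain v where v: "v \<in> T" "0 < g v" "g v < g u" "d b v < \<epsilon>'" using b[of \<epsilon>' "g u"] \<epsilon>' u by auto
    obtain w where w: "w \<in> T" "g w < g v" "d a w < \<epsilon>" using a[of \<epsilon> "g v"] \<epsilon> v by auto
    have "c \<preceq> v" using convex[of c w v u] \<epsilon> c u v w by auto
    then show False using \<epsilon>' v by auto
  qed
  obtain a where a: "a \<in> T"
    "\<forall>\<epsilon>>0. \<forall>\<delta>>0. \<exists>y\<in>T. 0 < g y \<and> g y < \<delta> \<and> True \<and> d a y < \<epsilon>"
    using cluster_point_exists[of g "\<lambda>_. True"] ex by auto
  have "near g a"
  proof (rule ccontr)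
    assume "\<not> near g a"
    then obtain \<epsilon> where \<epsilon>: "\<epsilon> > 0" "\<And>\<delta>. \<delta> > 0 \<Longrightarrow> \<exists>y\<in>T. 0 < g y \<and> g y < \<delta> \<and> \<epsilon> \<le> d a y"
      using a(1) unfolding near_def not_less[symmetric] by blast
    have "\<exists>b\<in>T. \<forall>\<epsilon>'>0. \<forall>\<delta>>0. \<exists>y\<in>T. 0 < g y \<and> g y < \<delta> \<and> \<epsilon> \<le> d a y \<and> d b y < \<epsilon>'"
      using \<epsilon>(2) by (rule cluster_point_exists)
    then obtain b where b: "b \<in> T"
      "\<forall>\<epsilon>'>0. \<forall>\<delta>>0. \<exists>y\<in>T. 0 < g y \<and> g y < \<delta> \<and> \<epsilon> \<le> d a y \<and> d b y < \<epsilon>'"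
      by (rule bexE)
    have cl: "\<exists>y\<in>T. 0 < g y \<and> g y < \<delta> \<and> d a y < \<epsilon>'" "\<exists>y\<in>T. 0 < g y \<and> g y < \<delta> \<and> d b y < \<epsilon>'"
      if "\<epsilon>' > 0" "\<delta> > 0" for \<epsilon>' \<delta>
      using a(2)[rule_format, OF that] b(2)[rule_format, OF that] by blast+
    \<comment> \<open>Two cluster points are ancestors of each other, yet b is a limit of points at
      distance at least \<open>\<epsilon>\<close> from a.\<close>
    have "a \<preceq> b" using a(1) b(1) cl by (rule below)
    moreover have "b \<preceq> a" using b(1) a(1) cl(2,1) by (rule below)
    ultimately have "a = b" using below_antisym[of a b] below_height[of b a] a b by auto
    then show False using b(2)[rule_format, OF \<epsilon>(1), of 1] by force
  qed
  then show ?thesis by blast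
qed

text \<open>No point has a value of \<open>F\<close> above m, so a limit from the right means
  nothing at t = m. The root is the value that fits \<open>F \<rho> = m\<close>.\<close>

definition explore :: "real \<Rightarrow> 'a" where
  "explore t = (if t < m then SOME a. near (\<lambda>y. F y - t) a else \<rho>)"

lemma near_explore:
  assumes "0 \<le> t" "t < m"
  shows "near (\<lambda>y. F y - t) (explore t)"
proof -
  have "\<exists>a. near (\<lambda>y. F y - t) a"
  proof (rule near_exists)
    show "\<exists>y\<in>T. 0 < F y - t \<and> F y - t < \<delta>" if "\<delta> > 0" for \<delta>
      using F_dense[of t "min (t + \<delta>) m"] assms that by force
  qed (auto intro: subtree_convex)
  then show ?thesis using assms by (simp add: explore_def someI_ex)
qed

lemma left_limit_exists:
  assumes "0 < t" "t \<le> m"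
  obtains a where "near (\<lambda>y. t - F y) a"
proof -
  have "\<exists>a. near (\<lambda>y. t - F y) a"
  proof (rule near_exists)
    show "\<exists>y\<in>T. 0 < t - F y \<and> t - F y < \<delta>" if "\<delta> > 0" for \<delta>
      using F_dense[of "max (t - \<delta>) 0" t] assms that by force
    show "c \<preceq> y" if "c \<in> T" "x \<in> T" "y \<in> T" "z \<in> T" "c \<preceq> x" "c \<preceq> z"
      "t - F x < t - F y" "t - F y < t - F z" for c x y z
      using subtree_convex[of c z y x] that by auto
  qed
  then show ?thesis using that by blast
qed

lemma explore_in: "0 \<le> t \<Longrightarrow> t \<le> m \<Longrightarrow> explore t \<in> T"
  using near_explore[of t] by (cases "t < m") (auto simp: near_def explore_def)

text \<open>Replaces \<open>explore t\<close> by points to which the order axioms apply. At t = m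
  the only witness is the root, so the strict inequality is confined to t < m.\<close>

lemma explore_approx:
  assumes "0 \<le> t" "t \<le> m" "\<epsilon> > 0" "\<delta> > 0"
  shows "\<exists>y\<in>T. t \<le> F y \<and> F y < t + \<delta> \<and> d (explore t) y < \<epsilon> \<and> (t < m \<longrightarrow> t < F y)"
proof (cases "t < m")
  case False
  then show ?thesis using assms F_root by (intro bexI[of _ \<rho>]) (simp_all add: explore_def)
next
  case True
  obtain \<eta> where \<eta>: "\<eta> > 0" "\<And>y. y \<in> T \<Longrightarrow> t < F y \<Longrightarrow> F y < t + \<eta> \<Longrightarrow> d (explore t) y < \<epsilon>"
    using near_explore[OF assms(1) True] assms(3) by (auto simp: near_def algebra_simps)
  obtain y where "y \<in> T" "t < F y" "F y < min (t + min \<eta> \<delta>) m"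
    using F_dense[of t "min (t + min \<eta> \<delta>) m"] assms True \<eta> by auto
  then show ?thesis using \<eta> by (intro bexI[of _ y]) auto
qed

text \<open>Let y be the limit at time \<open>F x\<close>. If x were not an ancestor of y, a
  separating strict ancestor c of x would come before all points tending to y, forcing
  \<open>F c = F x\<close>. If x were a strict ancestor of y, descendants of x would come after
  x.\<close>

lemma explore_F:
  assumes x: "x \<in> T"
  shows "explore (F x) = x"
proof (cases "F x < m")
  case False
  then have "x = \<rho>" using F_le[OF x] F_root F_eq_iff[of x \<rho>] x by auto
  then show ?thesis using F_root by (simp add: explore_def)
next
  case True
  define t where "t = F x"
  have t: "0 \<le> t" "t \<le> m" "t < m" using F_nonneg x True by (auto simp: t_def)
  define y where "y = explore t"
  have y: "y \<in> T" using explore_in t by (simp add: y_def)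
  have "x \<preceq> y"
  proof (rule ccontr)
    assume "\<not> x \<preceq> y"
    then obtain c where c: "c \<in> T" "c \<preceq> x" "c \<noteq> x" "\<not> c \<preceq> y" using separator x y by blast
    obtain \<epsilon> where \<epsilon>: "\<epsilon> > 0" "\<And>z. z \<in> T \<Longrightarrow> d y z < \<epsilon> \<Longrightarrow> \<not> c \<preceq> z"
      using not_below_nbhd c y by metis
    have "F c \<le> t + \<delta>" if \<delta>: "\<delta> > 0" for \<delta>
    proof -
      obtain z where "z \<in> T" "F x < F z" "F z < t + \<delta>" "d y z < \<epsilon>"
        using explore_approx[OF t(1,2) \<epsilon>(1) \<delta>] t by (metis t_def y_def)
      then show ?thesis using F_separated[of c x z] \<epsilon> c x by force
    qed
    then have "F c \<le> t" by (rule field_le_epsilon)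
    then show False using F_below[of c x] F_eq_iff[of c x] c x by (simp add: t_def)
  qed
  moreover have "x = y" if xy: "x \<preceq> y"
  proof (rule ccontr)
    assume "x \<noteq> y"
    then obtain \<epsilon> where \<epsilon>: "\<epsilon> > 0" "\<And>z. z \<in> T \<Longrightarrow> d y z < \<epsilon> \<Longrightarrow> x \<preceq> z"
      using below_nbhd[of x y] x y xy by metis
    obtain z where "z \<in> T" "F x < F z" "d y z < \<epsilon>"
      using explore_approx[OF t(1,2) \<epsilon>(1), of 1] t by (metis t_def y_def zero_less_one)
    then show False using F_below[of x z] \<epsilon> x by force
  qed
  ultimately show ?thesis by (simp add: y_def t_def)
qed

text \<open>Makes \<open>F x\<close> the last visit to x. Otherwise some z would come after x and
  before time t; a strict ancestor c of x separating it from z precedes z, yet descendants of c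
  close to x are found at times t or later.\<close>

lemma le_F_explore:
  assumes "0 \<le> t" "t \<le> m"
  shows "t \<le> F (explore t)"
proof (rule ccontr)
  define x where "x = explore t"
  have x: "x \<in> T" using explore_in assms by (simp add: x_def)
  assume "\<not> t \<le> F (explore t)"
  then obtain z where z: "z \<in> T" "F x < F z" "F z < t"
    using F_dense[of "F x" t] F_nonneg[OF x] assms by (auto simp: x_def)
  then have "\<not> x \<preceq> z" using F_below[of x z] x by auto
  then obtain c where c: "c \<in> T" "c \<preceq> x" "c \<noteq> x" "\<not> c \<preceq> z" using separator x z by blast
  then have Fc: "F c < F z" using F_separated x z by blast
  obtain \<epsilon> where \<epsilon>: "\<epsilon> > 0" "\<And>z. z \<in> T \<Longrightarrow> d x z < \<epsilon> \<Longrightarrow> c \<preceq> z"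
    using below_nbhd[of c x] x c by metis
  obtain y where "y \<in> T" "t \<le> F y" "d x y < \<epsilon>"
    using explore_approx[OF assms \<epsilon>(1), of 1] by (metis x_def zero_less_one)
  then show False using F_below[of c y] \<epsilon> c Fc z by force
qed

text \<open>The predicate \<open>near\<close> controls only points by their value of
  \<open>F\<close>. Since \<open>explore s\<close> is itself a limit of such points, the control
  transfers, with half of \<open>\<epsilon>\<close> for each step.\<close>

lemma explore_right:
  assumes "0 \<le> t" "t < m" "\<epsilon> > 0"
  obtains \<delta> where "\<delta> > 0" "\<And>s. t < s \<Longrightarrow> s < t + \<delta> \<Longrightarrow> s \<le> m \<Longrightarrow> d (explore t) (explore s) < \<epsilon>"
proof -
  obtain \<delta> where \<delta>: "\<delta> > 0" "\<And>y. y \<in> T \<Longrightarrow> t < F y \<Longrightarrow> F y < t + \<delta> \<Longrightarrow> d (explore t) y < \<epsilon> / 2"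
    using near_explore[OF assms(1,2)] assms(3) half_gt_zero[of \<epsilon>]
    unfolding near_def by (metis add.commute diff_less_eq diff_gt_0_iff_gt)
  have "d (explore t) (explore s) < \<epsilon>" if s: "t < s" "s < t + \<delta>" "s \<le> m" for s
  proof -
    have s0: "0 \<le> s" using s assms by simp
    obtain y where y: "y \<in> T" "s \<le> F y" "F y < s + (t + \<delta> - s)" "d (explore s) y < \<epsilon> / 2"
      using explore_approx[of s "\<epsilon> / 2" "t + \<delta> - s"] s s0 assms by (metis diff_gt_0_iff_gt half_gt_zero)
    have "d (explore t) y < \<epsilon> / 2" using \<delta>(2)[of y] y s by auto
    then show ?thesis
      using y(4) triangle[of "explore t" y "explore s"] explore_in[of s] explore_in[of t] s s0 assms y(1)
      by (auto simp: commute)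
  qed
  then show ?thesis using that \<delta>(1) by blast
qed

lemma explore_left:
  assumes "0 < t" "t \<le> m" "\<epsilon> > 0" and a: "near (\<lambda>y. t - F y) a"
  obtains \<delta> where "\<delta> > 0" "\<And>s. t - \<delta> < s \<Longrightarrow> s < t \<Longrightarrow> 0 \<le> s \<Longrightarrow> d a (explore s) < \<epsilon>"
proof -
  obtain \<delta> where \<delta>: "\<delta> > 0" "\<And>y. y \<in> T \<Longrightarrow> F y < t \<Longrightarrow> t - \<delta> < F y \<Longrightarrow> d a y < \<epsilon> / 2"
    using a assms(3) half_gt_zero[of \<epsilon>]
    unfolding near_def by (metis add.commute diff_less_eq diff_gt_0_iff_gt)
  have "d a (explore s) < \<epsilon>" if s: "t - \<delta> < s" "s < t" "0 \<le> s" for s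
  proof -
    have s0: "s \<le> m" using s assms by simp
    obtain y where y: "y \<in> T" "s \<le> F y" "F y < s + (t - s)" "d (explore s) y < \<epsilon> / 2"
      using explore_approx[of s "\<epsilon> / 2" "t - s"] s s0 assms by (metis diff_gt_0_iff_gt half_gt_zero)
    have "d a y < \<epsilon> / 2" using \<delta>(2)[of y] y s by auto
    moreover have "a \<in> T" using a by (simp add: near_def)
    ultimately show ?thesis
      using y(4) triangle[of a y "explore s"] explore_in[of s] s s0 y(1)
      by (auto simp: commute)
  qed
  then show ?thesis using that \<delta>(1) by blast
qed

text \<open>If the left limit \<open>a\<close> were not an ancestor of \<open>explore t\<close>, all points of a whole interval
  below \<open>a\<close> would be visited at the same time \<open>t\<close>.\<close>

lemma left_limit_below:
  assumes "0 < t" "t \<le> m" and a: "near (\<lambda>y. t - F y) a"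
  shows "a \<preceq> explore t"
proof (rule ccontr)
  define b where "b = explore t"
  have b: "b \<in> T" and aT: "a \<in> T" using explore_in assms by (auto simp: b_def near_def)
  assume "\<not> a \<preceq> explore t"
  then obtain h0 where h: "h0 < height a"
    "\<And>h. h0 < h \<Longrightarrow> h < height a \<Longrightarrow> \<exists>c\<in>T. c \<preceq> a \<and> c \<noteq> a \<and> \<not> c \<preceq> b \<and> height c = h"
    using obtain_separator[OF aT b] unfolding b_def by metis
  have Ft: "F c = t" if c: "c \<in> T" "c \<preceq> a" "c \<noteq> a" "\<not> c \<preceq> b" for c
  proof -
    obtain \<epsilon> where \<epsilon>: "\<epsilon> > 0" "\<And>z. z \<in> T \<Longrightarrow> d a z < \<epsilon> \<Longrightarrow> c \<preceq> z"
      using below_nbhd[of c a] c aT by metis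
    obtain \<epsilon>' where \<epsilon>': "\<epsilon>' > 0" "\<And>z. z \<in> T \<Longrightarrow> d b z < \<epsilon>' \<Longrightarrow> \<not> c \<preceq> z"
      using not_below_nbhd[of c b] c b by metis
    \<comment> \<open>Points near a just before t descend from c, so \<open>F c\<close> is not
      smaller than their values; points near b from t on do not, so c precedes them.\<close>
    have bounds: "t \<le> F c + \<eta> \<and> F c \<le> t + \<eta>" if \<eta>: "\<eta> > 0" for \<eta>
    proof -
      obtain \<delta> where \<delta>: "\<delta> > 0" "\<And>y. y \<in> T \<Longrightarrow> 0 < t - F y \<Longrightarrow> t - F y < \<delta> \<Longrightarrow> d a y < \<epsilon>"
        using a \<epsilon> unfolding near_def by metis
      obtain x where x: "x \<in> T" "max 0 (t - min \<delta> \<eta>) < F x" "F x < t"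
        using F_dense[of "max 0 (t - min \<delta> \<eta>)" t] assms \<delta> \<eta> by auto
      have cx: "c \<preceq> x" using \<delta>(2)[of x] \<epsilon>(2)[of x] x by auto
      obtain y where y: "y \<in> T" "t \<le> F y" "F y < t + \<eta>" "d b y < \<epsilon>'"
        using explore_approx[of t \<epsilon>' \<eta>] assms \<epsilon>' \<eta> by (metis b_def less_imp_le)
      have "F c < F y" using F_separated[of c x y] cx x y c \<epsilon>'(2)[of y] by auto
      moreover have "F x \<le> F c" using F_below cx x c by blast
      ultimately show ?thesis using x y by auto
    qed
    have "t \<le> F c" by (rule field_le_epsilon) (use bounds in auto)
    moreover have "F c \<le> t" by (rule field_le_epsilon) (use bounds in auto)
    ultimately show ?thesis by simp
  qed
  \<comment> \<open>Two separating ancestors at different heights would share the value t, against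
    injectivity of \<open>F\<close>.\<close>
  obtain k where k: "h0 < k" "k < height a" using dense[OF h(1)] by blast
  obtain k' where k': "k < k'" "k' < height a" using dense[OF k(2)] by blast
  obtain c where c: "c \<in> T" "c \<preceq> a" "c \<noteq> a" "\<not> c \<preceq> b" "height c = k" using h(2)[OF k] by blast
  obtain c' where c': "c' \<in> T" "c' \<preceq> a" "c' \<noteq> a" "\<not> c' \<preceq> b" "height c' = k'"
    using h(2)[of k'] k k' by auto
  have "F c = F c'" using Ft c c' by simp
  then show False using F_eq_iff c c' k' by auto
qed

section \<open>The contour function and its infima\<close>

definition contour :: "real \<Rightarrow> real" where
  "contour t = height (explore t)"

text \<open>A dip below e at time u would leave the descendants of some c and re-enter them by time
  t, against convexity.\<close>

lemma contour_ge_meet: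
  assumes "0 \<le> s" "s \<le> u" "u \<le> t" "t \<le> m" "e \<in> T" "e \<preceq> explore s" "e \<preceq> explore t"
  shows "height e \<le> contour u"
proof (rule ccontr)
  assume "\<not> height e \<le> contour u"
  then have less: "contour u < height e" by simp
  define x y w where "x = explore s" and "y = explore t" and "w = explore u"
  have T: "x \<in> T" "y \<in> T" "w \<in> T" using assms explore_in by (auto simp: x_def y_def w_def)
  have ex: "e \<preceq> x" "e \<preceq> y" using assms by (auto simp: x_def y_def)
  have hxy: "height e \<le> height x" "height e \<le> height y" using ex below_height by auto
  have wlt: "height w < height e" using less by (simp add: contour_def w_def)
  then have "u \<noteq> s" "u \<noteq> t" using hxy by (auto simp: x_def y_def w_def)
  then have su: "s < u" "u < t" using assms by auto
  \<comment> \<open>The height is strictly below that of e, so that c differs from x and y even if e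
    is one of them, and \<open>below_nbhd\<close> applies.\<close>
  obtain h where h: "height w < h" "h < height e" using dense[OF wlt] by blast
  obtain c where c: "c \<in> T" "c \<preceq> e" "height c = h"
    using obtain_height[of e h] assms(5) h nonneg[of \<rho> w] by (metis less_imp_le order_trans)
  have cxy: "c \<preceq> x" "c \<preceq> y" using below_trans[OF c(2) ex(1)] below_trans[OF c(2) ex(2)] c(1) T assms(5) by auto
  have ne: "c \<noteq> x" "c \<noteq> y" "\<not> c \<preceq> w" using h c hxy below_height[of c w] by auto
  obtain \<epsilon> where \<epsilon>: "\<epsilon> > 0" "\<And>z. z \<in> T \<Longrightarrow> d x z < \<epsilon> \<Longrightarrow> c \<preceq> z"
    using below_nbhd[of c x] c T cxy ne by metis
  obtain \<epsilon>' where \<epsilon>': "\<epsilon>' > 0" "\<And>z. z \<in> T \<Longrightarrow> d y z < \<epsilon>' \<Longrightarrow> c \<preceq> z"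
    using below_nbhd[of c y] c T cxy ne by metis
  obtain \<epsilon>'' where \<epsilon>'': "\<epsilon>'' > 0" "\<And>z. z \<in> T \<Longrightarrow> d w z < \<epsilon>'' \<Longrightarrow> \<not> c \<preceq> z"
    using not_below_nbhd[of c w] c T ne by metis
  obtain x' where x': "x' \<in> T" "F x' < u" "d x x' < \<epsilon>"
    using explore_approx[of s \<epsilon> "u - s"] assms \<epsilon> su by (auto simp: x_def)
  obtain y' where y': "y' \<in> T" "t \<le> F y'" "d y y' < \<epsilon>'"
    using explore_approx[of t \<epsilon>' 1] assms \<epsilon>' su by (auto simp: y_def)
  obtain w' where w': "w' \<in> T" "u < F w'" "F w' < t" "d w w' < \<epsilon>''"
    using explore_approx[of u \<epsilon>'' "t - u"] assms \<epsilon>'' su by (auto simp: w_def)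
  have "c \<preceq> w'" using subtree_convex[of c x' w' y'] c x' y' w' \<epsilon> \<epsilon>' by auto
  then show False using \<epsilon>'' w' by auto
qed

text \<open>The geodesic from \<open>explore s\<close> down to the branch point \<open>e\<close> is visited between \<open>s\<close> and \<open>t\<close>.\<close>

lemma contour_near_meet:
  assumes "0 \<le> s" "s \<le> t" "t \<le> m" "e \<in> T" "e \<preceq> explore s" "e \<preceq> explore t" "\<eta> > 0"
    and great: "\<And>c. c \<in> T \<Longrightarrow> c \<preceq> explore s \<Longrightarrow> c \<preceq> explore t \<Longrightarrow> height c \<le> height e"
  shows "\<exists>u\<in>{s..t}. contour u < height e + \<eta>"
proof (cases "explore s \<preceq> explore t")
  case True
  then have "height (explore s) \<le> height e" using great[of "explore s"] explore_in[of s] assms by auto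
  then show ?thesis using assms by (intro bexI[of _ s]) (auto simp: contour_def)
next
  case False
  define x y where "x = explore s" and "y = explore t"
  have T: "x \<in> T" "y \<in> T" using assms explore_in by (auto simp: x_def y_def)
  have nxy: "\<not> x \<preceq> y" using False by (simp add: x_def y_def)
  then have "s \<noteq> t" using T by (auto simp: x_def y_def)
  then have st: "s < t" using assms by simp
  have "height e < height x"
    using below_antisym[of e x] assms(4-6) nxy T below_height[of e x] unfolding x_def y_def by force
  then have "height e < min (height x) (height e + \<eta>)" using assms by simp
  from dense[OF this] obtain h where h: "height e < h" "h < height x" "h < height e + \<eta>" by auto
  obtain c where c: "c \<in> T" "c \<preceq> x" "height c = h"
    using obtain_height[of x h] T h nonneg[of \<rho> e] by (metis less_imp_le order_trans)
  have ncy: "\<not> c \<preceq> y" "c \<noteq> x" using great[of c] c h by (auto simp: x_def y_def)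
  obtain \<epsilon> where \<epsilon>: "\<epsilon> > 0" "\<And>z. z \<in> T \<Longrightarrow> d x z < \<epsilon> \<Longrightarrow> c \<preceq> z"
    using below_nbhd[of c x] c T ncy by metis
  obtain \<epsilon>' where \<epsilon>': "\<epsilon>' > 0" "\<And>z. z \<in> T \<Longrightarrow> d y z < \<epsilon>' \<Longrightarrow> \<not> c \<preceq> z"
    using not_below_nbhd[of c y] c T ncy by metis
  obtain x' where x': "x' \<in> T" "s \<le> F x'" "F x' < t" "d x x' < \<epsilon>"
    using explore_approx[of s \<epsilon> "t - s"] assms \<epsilon> st by (auto simp: x_def)
  have cx': "c \<preceq> x'" using \<epsilon> x' by auto
  \<comment> \<open>The witness will be \<open>F c\<close>, the time at which c, slightly above e,
    is visited. Separation bounds it by the values of points approaching y.\<close>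
  have "F c \<le> t"
  proof (rule field_le_epsilon)
    fix \<delta> :: real assume "\<delta> > 0"
    then obtain y' where y': "y' \<in> T" "t \<le> F y'" "F y' < t + \<delta>" "d y y' < \<epsilon>'"
      using explore_approx[of t \<epsilon>' \<delta>] assms \<epsilon>' st by (auto simp: y_def)
    then show "F c \<le> t + \<delta>" using F_separated[of c x' y'] c x' cx' \<epsilon>'(2)[of y'] by auto
  qed
  moreover have "s \<le> F c" using F_below[of c x'] c x' cx' by auto
  moreover have "contour (F c) < height e + \<eta>" using explore_F c h by (simp add: contour_def)
  ultimately show ?thesis by (intro bexI[of _ "F c"]) auto
qed

lemma Inf_contour:
  assumes "0 \<le> s" "s \<le> t" "t \<le> m" "e \<in> T" "e \<preceq> explore s" "e \<preceq> explore t"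
    and great: "\<And>c. c \<in> T \<Longrightarrow> c \<preceq> explore s \<Longrightarrow> c \<preceq> explore t \<Longrightarrow> height c \<le> height e"
  shows "(INF u\<in>{s..t}. contour u) = height e"
proof (rule antisym)
  have bdd: "bdd_below (contour ` {s..t})"
    by (rule bdd_belowI[of _ 0]) (auto simp: contour_def)
  show "(INF u\<in>{s..t}. contour u) \<le> height e"
  proof (rule field_le_epsilon)
    fix \<eta> :: real assume "\<eta> > 0"
    then obtain u where "s \<le> u" "u \<le> t" "contour u < height e + \<eta>"
      using contour_near_meet[OF assms(1-6) _ great] by (meson atLeastAtMost_iff)
    then show "(INF u\<in>{s..t}. contour u) \<le> height e + \<eta>"
      using cINF_lower2[OF bdd, of u "height e + \<eta>"] by auto
  qed
  show "height e \<le> (INF u\<in>{s..t}. contour u)"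
    using contour_ge_meet[OF assms(1) _ _ assms(3-6)] assms(2) by (intro cINF_greatest) auto
qed

text \<open>With the infimum equal to the height of the branch point, the formula adds the two
  descents to that point.\<close>

lemma code_dist_contour:
  assumes "s \<in> {0..m}" "t \<in> {0..m}"
  shows "code_dist contour s t = d (explore s) (explore t)"
proof -
  have *: "code_dist contour s t = d (explore s) (explore t)" if st: "0 \<le> s" "s \<le> t" "t \<le> m" for s t
  proof -
    have T: "explore s \<in> T" "explore t \<in> T" using explore_in st by auto
    obtain e where e: "e \<in> T" "e \<preceq> explore s" "e \<preceq> explore t"
      "d (explore s) (explore t) = d e (explore s) + d e (explore t)"
      "\<And>c. c \<in> T \<Longrightarrow> c \<preceq> explore s \<Longrightarrow> c \<preceq> explore t \<Longrightarrow> height c \<le> height e"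
      using meet_exists[OF T] by metis
    have "(INF u\<in>{min s t..max s t}. contour u) = height e"
      using Inf_contour[OF st e(1-3,5)] st by simp
    then show ?thesis using e(2,3,4) by (simp add: code_dist_def contour_def below_def)
  qed
  show ?thesis
  proof (cases "s \<le> t")
    case True then show ?thesis using * assms by auto
  next
    case False
    then have "code_dist contour t s = d (explore t) (explore s)" using * assms by auto
    then show ?thesis by (simp add: code_dist_def commute min.commute max.commute)
  qed
qed

lemma contour_diff:
  assumes "a \<in> T" "0 \<le> s" "s \<le> m"
  shows "\<bar>contour s - height a\<bar> \<le> d a (explore s)"
  using triangle[of \<rho> a "explore s"] triangle[of \<rho> "explore s" a] explore_in[of s] assms
  by (auto simp: contour_def commute)

lemma contour_left:
  assumes "0 < t" "t \<le> m" and a: "near (\<lambda>y. t - F y) a"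
  shows "(contour \<longlongrightarrow> height a) (at_left t)"
proof (rule tendstoI)
  fix \<epsilon> :: real assume "\<epsilon> > 0"
  then obtain \<delta> where \<delta>: "\<delta> > 0" "\<And>s. t - \<delta> < s \<Longrightarrow> s < t \<Longrightarrow> 0 \<le> s \<Longrightarrow> d a (explore s) < \<epsilon>"
    using explore_left[OF assms(1,2) _ a] by metis
  have "dist (contour s) (height a) < \<epsilon>" if "max 0 (t - \<delta>) < s" "s < t" for s
    using \<delta>(2)[of s] contour_diff[of a s] a that assms by (auto simp: dist_real_def near_def)
  then show "eventually (\<lambda>s. dist (contour s) (height a) < \<epsilon>) (at_left t)"
    using \<delta>(1) assms by (intro eventually_at_leftI[of "max 0 (t - \<delta>)"]) auto
qed

lemma contour_right:
  assumes "0 \<le> t" "t < m"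
  shows "(contour \<longlongrightarrow> contour t) (at_right t)"
proof (rule tendstoI)
  fix \<epsilon> :: real assume "\<epsilon> > 0"
  then obtain \<delta> where \<delta>: "\<delta> > 0"
    "\<And>s. t < s \<Longrightarrow> s < t + \<delta> \<Longrightarrow> s \<le> m \<Longrightarrow> d (explore t) (explore s) < \<epsilon>"
    using explore_right[OF assms] by metis
  have "dist (contour s) (contour t) < \<epsilon>" if "t < s" "s < min m (t + \<delta>)" for s
    using \<delta>(2)[of s] contour_diff[of "explore t" s] explore_in[of t] that assms
    by (auto simp: dist_real_def contour_def)
  then show "eventually (\<lambda>s. dist (contour s) (contour t) < \<epsilon>) (at_right t)"
    using \<delta>(1) assms by (intro eventually_at_rightI[of t "min m (t + \<delta>)"]) auto
qed

lemma coding_function_contour: "coding_function m contour"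
  unfolding coding_function_def cadlag_on_def no_negative_jumps_on_def
proof (intro conjI ballI allI impI)
  show "(contour \<longlongrightarrow> contour t) (at_right t)" if "t \<in> {0..<m}" for t
    using contour_right that by auto
  show "\<exists>l. (contour \<longlongrightarrow> l) (at_left t)" if "t \<in> {0<..m}" for t
    using left_limit_exists[of t] contour_left[of t] that by auto
  show "l \<le> contour t" if t: "t \<in> {0<..m}" and l: "(contour \<longlongrightarrow> l) (at_left t)" for t l
  proof -
    obtain a where a: "near (\<lambda>y. t - F y) a" using left_limit_exists[of t] t by auto
    have "l = height a"
      using tendsto_unique[OF _ l contour_left[of t a]] t a trivial_limit_at_left_real by auto
    \<comment> \<open>The left limit is the height of an ancestor of \<open>explore t\<close>, so a
      jump can only go up.\<close>
    then show ?thesis using left_limit_below[of t a] below_height a t by (auto simp: contour_def)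
  qed
  show "0 \<le> contour t" for t by (simp add: contour_def)
  show "contour m = 0" by (simp add: contour_def explore_def)
qed

end


section \<open>Borel sets of metric spaces given by carriers\<close>

lemma space_metric_borel [simp]: "Metric_space T d \<Longrightarrow> space (metric_borel T d) = T"
  unfolding metric_borel_def
  by (rule space_measure_of) (use openin_subset Metric_space.topspace_mtopology in fastforce)

lemma openin_sets_metric_borel:
  assumes "Metric_space T d" "openin (Metric_space.mtopology T d) U"
  shows "U \<in> sets (metric_borel T d)"
proof -
  have "{U. openin (Metric_space.mtopology T d) U} \<subseteq> Pow T"
    using openin_subset Metric_space.topspace_mtopology[OF assms(1)] by fastforce
  then show ?thesis unfolding metric_borel_def using assms(2) by (auto simp: sets_measure_of)
qed

lemma measurable_metric_borelI:
  assumes "Metric_space T d" "f \<in> space M \<rightarrow> T"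
    "\<And>U. openin (Metric_space.mtopology T d) U \<Longrightarrow> f -` U \<inter> space M \<in> sets M"
  shows "f \<in> measurable M (metric_borel T d)"
  unfolding metric_borel_def
proof (rule measurable_measure_of)
  show "{U. openin (Metric_space.mtopology T d) U} \<subseteq> Pow T"
    using openin_subset Metric_space.topspace_mtopology[OF assms(1)] by fastforce
qed (use assms in auto)

lemma openin_isometry_vimage:
  assumes T: "Metric_space T d" and T': "Metric_space T' d'"
    and h: "h ` T \<subseteq> T'" "\<And>x y. x \<in> T \<Longrightarrow> y \<in> T \<Longrightarrow> d' (h x) (h y) = d x y"
    and U: "openin (Metric_space.mtopology T' d') U"
  shows "openin (Metric_space.mtopology T d) (h -` U \<inter> T)"
proof -
  interpret T: Metric_space T d by fact
  interpret T': Metric_space T' d' by fact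
  have "\<exists>r>0. T.mball x r \<subseteq> h -` U \<inter> T" if x: "x \<in> h -` U \<inter> T" for x
  proof -
    obtain r where r: "r > 0" "T'.mball (h x) r \<subseteq> U"
      using U x by (auto simp: T'.openin_mtopology)
    then have "T.mball x r \<subseteq> h -` U \<inter> T"
      using h x by (auto simp: subset_iff)
    then show ?thesis using r by blast
  qed
  then show ?thesis by (auto simp: T.openin_mtopology)
qed

lemma isometry_measurable:
  assumes T: "Metric_space T d" and T': "Metric_space T' d'"
    and h: "h ` T \<subseteq> T'" "\<And>x y. x \<in> T \<Longrightarrow> y \<in> T \<Longrightarrow> d' (h x) (h y) = d x y"
  shows "h \<in> measurable (metric_borel T d) (metric_borel T' d')"
  using openin_isometry_vimage[OF assms] openin_sets_metric_borel[OF T] h(1) T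
  by (intro measurable_metric_borelI[OF T']) auto

text \<open>Serves the right-continuous map \<open>explore\<close>, whose preimages of open sets
  need not be open. Only countably many points of S fail to be interior, since the intervals to
  their right are disjoint.\<close>

lemma right_open_borel:
  fixes S :: "real set"
  assumes "\<And>t. t \<in> S \<Longrightarrow> \<exists>e>t. {t<..<e} \<subseteq> S"
  shows "S \<in> sets borel"
proof -
  define D where "D = S - interior S"
  have "\<forall>t\<in>S. \<exists>e>t. {t<..<e} \<subseteq> S" using assms by blast
  then obtain e where e: "\<And>t. t \<in> S \<Longrightarrow> e t > t" "\<And>t. t \<in> S \<Longrightarrow> {t<..<e t} \<subseteq> S"
    by metis
  have int: "{t<..<e t} \<subseteq> interior S" if "t \<in> S" for t
    using e(2)[OF that] by (rule interior_maximal) simp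
  \<comment> \<open>A point of D is not interior to S, so it cannot fall into the interval attached
    to an earlier one.\<close>
  have later: "e t \<le> t'" if "t \<in> D" "t' \<in> D" "t < t'" for t t'
    using int[of t] that by (force simp: D_def)
  define I where "I t = {t<..<e t}" for t
  have disj: "disjnt (I t) (I t')" if "t \<in> D" "t' \<in> D" "t \<noteq> t'" for t t'
    using later[of t t'] later[of t' t] that unfolding I_def disjnt_def
    by (cases "t < t'") auto
  have ne: "I t \<noteq> {}" if "t \<in> D" for t
    using e(1)[of t] that by (auto simp: I_def D_def)
  have "countable (I ` D)"
    by (rule countable_disjoint_open_subsets) (auto simp: pairwise_def I_def intro: disj[unfolded I_def])
  moreover have "inj_on I D"
  proof (rule inj_onI, rule ccontr)
    fix t t' assume "t \<in> D" "t' \<in> D" "I t = I t'" "t \<noteq> t'"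
    then show False using disj[of t t'] ne[of t] by (auto simp: disjnt_def)
  qed
  ultimately have "countable D" by (rule countable_image_inj_on)
  then have "D \<in> sets borel" by (rule sets.countable[rotated]) auto
  moreover have "S = interior S \<union> D" using interior_subset by (auto simp: D_def)
  ultimately show ?thesis by (metis borel_open open_interior sets.Un)
qed


section \<open>The tree coded by a nonnegative function\<close>

lemma code_dist_commute: "code_dist f s t = code_dist f t s"
  by (simp add: code_dist_def min.commute max.commute)

lemma code_dist_cong:
  assumes "\<And>t. t \<in> {0..m} \<Longrightarrow> f t = g t" "s \<in> {0..m}" "t \<in> {0..m}"
  shows "code_dist f s t = code_dist g s t"
proof -
  have "(INF u\<in>{min s t..max s t}. f u) = (INF u\<in>{min s t..max s t}. g u)"
    using assms by (intro INF_cong) (auto simp: min_def max_def split: if_splits)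
  then show ?thesis using assms by (simp add: code_dist_def)
qed

lemma code_dist_self [simp]: "code_dist f t t = 0"
  by (simp add: code_dist_def)

lemma code_equiv_cong:
  assumes "\<And>t. t \<in> {0..m} \<Longrightarrow> f t = g t"
  shows "code_equiv m f = code_equiv m g"
  using code_dist_cong[of m f g] assms by (auto simp: code_equiv_def)

text \<open>Nonnegativity bounds the infima from below. The locale is used for
  \<open>contour\<close> and again for an arbitrary coding function in the final theorem.\<close>

locale nonneg_code =
  fixes m :: real and f :: "real \<Rightarrow> real"
  assumes code_nonneg: "\<And>t. t \<in> {0..m} \<Longrightarrow> 0 \<le> f t"
begin

abbreviation Q :: "real set set" where
  "Q \<equiv> {0..m} // code_equiv m f"

definition low :: "real \<Rightarrow> real \<Rightarrow> real" where
  "low s t = (INF u\<in>{min s t..max s t}. f u)"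

lemma low_le:
  assumes "s \<in> {0..m}" "t \<in> {0..m}" "u \<in> {min s t..max s t}"
  shows "low s t \<le> f u"
  unfolding low_def
proof (rule cINF_lower)
  have "{min s t..max s t} \<subseteq> {0..m}" using assms by auto
  then show "bdd_below (f ` {min s t..max s t})"
    using code_nonneg by (intro bdd_belowI[of _ 0]) blast
qed (fact assms(3))

lemma low_ends:
  assumes "s \<in> {0..m}" "t \<in> {0..m}"
  shows "low s t \<le> f s" "low s t \<le> f t"
  using low_le[OF assms, of s] low_le[OF assms, of t] by auto

text \<open>The interval between s and u is covered by the other two. This ultrametric inequality
  for minima yields the triangle inequality of \<open>code_dist\<close>.\<close>

lemma low_triangle:
  assumes "s \<in> {0..m}" "t \<in> {0..m}" "u \<in> {0..m}"
  shows "min (low s t) (low t u) \<le> low s u"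
  unfolding low_def[of s u]
proof (rule cINF_greatest)
  fix v assume v: "v \<in> {min s u..max s u}"
  then have "v \<in> {min s t..max s t} \<or> v \<in> {min t u..max t u}" by auto
  then show "min (low s t) (low t u) \<le> f v"
    using low_le[OF assms(1,2), of v] low_le[OF assms(2,3), of v] by linarith
qed simp

lemma code_dist_low: "code_dist f s t = f s + f t - 2 * low s t"
  by (simp add: code_dist_def low_def)

lemma code_dist_nonneg: "s \<in> {0..m} \<Longrightarrow> t \<in> {0..m} \<Longrightarrow> 0 \<le> code_dist f s t"
  using low_ends[of s t] by (simp add: code_dist_low)

lemma code_dist_triangle:
  assumes "s \<in> {0..m}" "t \<in> {0..m}" "u \<in> {0..m}"
  shows "code_dist f s u \<le> code_dist f s t + code_dist f t u"
  using low_triangle[OF assms] low_ends[OF assms(1,2)] low_ends[OF assms(2,3)]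
  unfolding code_dist_low by linarith

lemma equiv_code: "equiv {0..m} (code_equiv m f)"
proof (rule equivI)
  show "trans (code_equiv m f)"
  proof (rule transI)
    fix s t u assume "(s, t) \<in> code_equiv m f" "(t, u) \<in> code_equiv m f"
    then show "(s, u) \<in> code_equiv m f"
      using code_dist_triangle[of s t u] code_dist_nonneg[of s u] by (auto simp: code_equiv_def)
  qed
qed (auto simp: code_equiv_def refl_on_def sym_def code_dist_commute)

text \<open>Moving to the representatives picked by \<open>SOME\<close> costs distance 0 at each
  end, so the triangle inequality in both directions gives equality.\<close>

lemma quotient_dist_class:
  assumes "s \<in> {0..m}" "t \<in> {0..m}"
  shows "quotient_dist m f (code_equiv m f `` {s}) (code_equiv m f `` {t}) = code_dist f s t"
proof -
  have rep: "(s, SOME u. u \<in> code_equiv m f `` {s}) \<in> code_equiv m f" if "s \<in> {0..m}" for s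
    using someI[of "\<lambda>u. u \<in> code_equiv m f `` {s}" s] equiv_class_self[OF equiv_code that] by simp
  define a where "a = (SOME u. u \<in> code_equiv m f `` {s})"
  define b where "b = (SOME u. u \<in> code_equiv m f `` {t})"
  have ab: "a \<in> {0..m}" "b \<in> {0..m}" "code_dist f s a = 0" "code_dist f t b = 0"
    using rep[OF assms(1)] rep[OF assms(2)] by (auto simp: code_equiv_def a_def b_def)
  have "code_dist f a b = code_dist f s t"
    using code_dist_triangle[of a s b] code_dist_triangle[of s t b]
      code_dist_triangle[of s a t] code_dist_triangle[of a b t]
      assms ab code_dist_commute[of f a s] code_dist_commute[of f b t] by linarith
  then show ?thesis using assms by (simp add: quotient_dist_def quotientI a_def b_def)
qed

lemma Metric_space_quotient: "Metric_space Q (quotient_dist m f)"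
proof
  show "0 \<le> quotient_dist m f A B" for A B
  proof (cases "A \<in> Q \<and> B \<in> Q")
    case True
    then show ?thesis
      by (auto elim!: quotientE simp: quotient_dist_class intro: code_dist_nonneg simp del: atLeastAtMost_iff)
  qed (auto simp: quotient_dist_def)
  show "quotient_dist m f A B = quotient_dist m f B A" for A B
    by (simp add: quotient_dist_def code_dist_commute conj_commute)
  show "quotient_dist m f A B = 0 \<longleftrightarrow> A = B" if "A \<in> Q" "B \<in> Q" for A B
    using that
  proof (elim quotientE)
    fix s t assume st: "A = code_equiv m f `` {s}" "s \<in> {0..m}" "B = code_equiv m f `` {t}" "t \<in> {0..m}"
    have "A = B \<longleftrightarrow> (s, t) \<in> code_equiv m f"
      using st eq_equiv_class_iff[OF equiv_code] by simp
    moreover have "(s, t) \<in> code_equiv m f \<longleftrightarrow> code_dist f s t = 0"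
      using st by (simp add: code_equiv_def)
    ultimately show ?thesis using quotient_dist_class st by simp
  qed
  show "quotient_dist m f A C \<le> quotient_dist m f A B + quotient_dist m f B C"
    if "A \<in> Q" "B \<in> Q" "C \<in> Q" for A B C
    using that
    by (auto elim!: quotientE simp: quotient_dist_class intro: code_dist_triangle simp del: atLeastAtMost_iff)
qed

end

text \<open>The final claim compares functions on \<open>[0, m]\<close> only. Chosen representatives
  belong to their classes, hence lie in this interval.\<close>

lemma coded_tree_cong:
  assumes eq: "\<And>t. t \<in> {0..m} \<Longrightarrow> f t = g t"
  shows "coded_tree m f = coded_tree m g"
proof -
  have ceq: "code_equiv m f = code_equiv m g" using eq by (rule code_equiv_cong)
  have "quotient_dist m f A B = quotient_dist m g A B" for A B
  proof (cases "A \<in> {0..m} // code_equiv m g \<and> B \<in> {0..m} // code_equiv m g")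
    case True
    have "(SOME s. s \<in> A) \<in> {0..m}" if A: "A \<in> {0..m} // code_equiv m g" for A
    proof -
      obtain s where s: "s \<in> {0..m}" "A = code_equiv m g `` {s}" using quotientE[OF A] by metis
      then have "s \<in> A" by (auto simp: code_equiv_def)
      then have "(SOME s. s \<in> A) \<in> A" by (rule someI)
      then show ?thesis using s by (auto simp: code_equiv_def)
    qed
    then show ?thesis
      using True code_dist_cong[OF eq] by (simp add: quotient_dist_def ceq)
  qed (auto simp: quotient_dist_def ceq)
  then have "quotient_dist m f = quotient_dist m g" by blast
  then show ?thesis by (simp add: coded_tree_def ceq)
qed

text \<open>The second map factors through the first: points with the same image under the first are at
  distance \<open>0\<close>, so they have the same image under the second.\<close>

lemma tom_isomorphic_common_source:
  assumes q: "Metric_space (points q) (distance q)"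
      "sets (mass q) = sets (metric_borel (points q) (distance q))"
    and c: "Metric_space (points c) (distance c)"
      "sets (mass c) = sets (metric_borel (points c) (distance c))"
    and c': "Metric_space (points c') (distance c')"
      "sets (mass c') = sets (metric_borel (points c') (distance c'))"
    and qc: "tom_isomorphic q c" and qc': "tom_isomorphic q c'"
  shows "tom_isomorphic c c'"
proof -
  obtain h where h: "h ` points q = points c"
    "\<And>x y. x \<in> points q \<Longrightarrow> y \<in> points q \<Longrightarrow> distance c (h x) (h y) = distance q x y"
    "\<And>x y. x \<in> points q \<Longrightarrow> y \<in> points q \<Longrightarrow> (h x, h y) \<in> ord c \<longleftrightarrow> (x, y) \<in> ord q"
    "distr (mass q) (mass c) h = mass c"
    using qc unfolding tom_isomorphic_def by blast
  obtain h' where h': "h' ` points q = points c'"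
    "\<And>x y. x \<in> points q \<Longrightarrow> y \<in> points q \<Longrightarrow> distance c' (h' x) (h' y) = distance q x y"
    "\<And>x y. x \<in> points q \<Longrightarrow> y \<in> points q \<Longrightarrow> (h' x, h' y) \<in> ord c' \<longleftrightarrow> (x, y) \<in> ord q"
    "distr (mass q) (mass c') h' = mass c'"
    using qc' unfolding tom_isomorphic_def by blast
  define k where "k = inv_into (points q) h"
  define g where "g = h' \<circ> k"
  have k: "k x \<in> points q" "h (k x) = x" if "x \<in> points c" for x
    using that inv_into_into[of x h "points q"] f_inv_into_f[of x h "points q"] h(1)
    by (auto simp: k_def)
  have gh: "g (h a) = h' a" if a: "a \<in> points q" for a
  proof -
    have ha: "h a \<in> points c" using a h(1) by auto
    have "distance c' (h' (k (h a))) (h' a) = distance c (h (k (h a))) (h a)"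
      using h(2) h'(2) k(1)[OF ha] a by simp
    also have "\<dots> = 0" using k(2)[OF ha] Metric_space.zero[OF c(1) ha ha] by simp
    finally show ?thesis
      using Metric_space.zero[OF c'(1)] k(1)[OF ha] a h'(1) by (auto simp: g_def)
  qed
  have g: "g ` points c = points c'"
    "\<And>x y. x \<in> points c \<Longrightarrow> y \<in> points c \<Longrightarrow> distance c' (g x) (g y) = distance c x y"
    "\<And>x y. x \<in> points c \<Longrightarrow> y \<in> points c \<Longrightarrow> (g x, g y) \<in> ord c' \<longleftrightarrow> (x, y) \<in> ord c"
  proof -
    show "g ` points c = points c'" using gh h(1) h'(1) by (metis (no_types, lifting) image_cong image_image)
    show "distance c' (g x) (g y) = distance c x y" if "x \<in> points c" "y \<in> points c" for x y
      using h(2)[of "k x" "k y"] h'(2)[of "k x" "k y"] k that by (simp add: g_def)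
    show "(g x, g y) \<in> ord c' \<longleftrightarrow> (x, y) \<in> ord c" if "x \<in> points c" "y \<in> points c" for x y
      using h(3)[of "k x" "k y"] h'(3)[of "k x" "k y"] k that by (simp add: g_def)
  qed
  have mh: "h \<in> measurable (mass q) (mass c)"
    using isometry_measurable[OF q(1) c(1)] h measurable_cong_sets[OF q(2) c(2)] by auto
  have mg: "g \<in> measurable (mass c) (mass c')"
    using isometry_measurable[OF c(1) c'(1)] g measurable_cong_sets[OF c(2) c'(2)] by auto
  have "distr (mass c) (mass c') g = distr (distr (mass q) (mass c) h) (mass c') g" by (simp add: h(4))
  also have "\<dots> = distr (mass q) (mass c') (g \<circ> h)" using mg mh by (rule distr_distr)
  also have "\<dots> = distr (mass q) (mass c') h'"
  proof (rule distr_cong)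
    show "(g \<circ> h) x = h' x" if "x \<in> space (mass q)" for x
      using that gh q(1) sets_eq_imp_space_eq[OF q(2)] by simp
  qed simp_all
  also have "\<dots> = mass c'" by (rule h'(4))
  finally show ?thesis using g unfolding tom_isomorphic_def by blast
qed


section \<open>The mass below a point\<close>

locale compact_tom =
  fixes c :: "'a tom_structure"
  assumes compact_tom: "compact_TOM_tree c"

sublocale compact_tom \<subseteq> rooted_tree "points c" "distance c" "root c"
  using compact_tom by unfold_locales (auto simp: compact_TOM_tree_def TOM_tree_def Let_def)

context compact_tom
begin

abbreviation "T \<equiv> points c"
abbreviation "d \<equiv> distance c"
abbreviation "\<rho> \<equiv> root c"
abbreviation "\<mu> \<equiv> mass c"

definition le :: "'a \<Rightarrow> 'a \<Rightarrow> bool" where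
  "le x y \<longleftrightarrow> (x, y) \<in> ord c"

lemmas tom_defs = compact_TOM_tree_def TOM_tree_def Let_def

lemma linear: "linear_order_on T (ord c)"
  using compact_tom unfolding tom_defs by (elim conjE)

lemma sets_mass: "sets \<mu> = sets (metric_borel T d)"
  using compact_tom unfolding tom_defs by (elim conjE)

lemma compact: "compact_space mtopology"
  using compact_tom unfolding tom_defs by (elim conjE)

lemma Or1:
  assumes "x \<in> T" "y \<in> T" "ancestor T d \<rho> x y"
  shows "(y, x) \<in> ord c"
proof -
  have "\<forall>x\<in>T. \<forall>y\<in>T. ancestor T d \<rho> x y \<longrightarrow> (y, x) \<in> ord c"
    using compact_tom unfolding tom_defs by (elim conjE)
  then show ?thesis using assms by blast
qed

lemma Or2:
  assumes "x \<in> T" "y \<in> T" "(x, y) \<in> ord c" "x \<noteq> y"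
    "z \<in> segment T d x (branch_point T d \<rho> x y) - {branch_point T d \<rho> x y}"
  shows "(z, y) \<in> ord c \<and> z \<noteq> y"
proof -
  have "\<forall>x\<in>T. \<forall>y\<in>T. (x, y) \<in> ord c \<and> x \<noteq> y \<longrightarrow>
     (\<forall>z \<in> segment T d x (branch_point T d \<rho> x y) - {branch_point T d \<rho> x y}.
        (z, y) \<in> ord c \<and> z \<noteq> y)"
    using compact_tom unfolding tom_defs by (elim conjE)
  then show ?thesis using assms by blast
qed

lemma locally_finite:
  assumes "x \<in> T"
  shows "\<exists>U. openin mtopology U \<and> x \<in> U \<and> emeasure \<mu> U < \<infinity>"
proof -
  have "\<forall>x\<in>T. \<exists>U. openin mtopology U \<and> x \<in> U \<and> emeasure \<mu> U < \<infinity>"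
    using compact_tom unfolding tom_defs by (elim conjE)
  then show ?thesis using assms by blast
qed

lemma interval_pos:
  assumes "x \<in> T" "y \<in> T" "(x, y) \<in> ord c" "x \<noteq> y"
  shows "emeasure \<mu> {z\<in>T. (x, z) \<in> ord c \<and> (z, y) \<in> ord c} > 0"
proof -
  have "\<forall>x\<in>T. \<forall>y\<in>T. (x, y) \<in> ord c \<and> x \<noteq> y \<longrightarrow>
      emeasure \<mu> {z\<in>T. (x, z) \<in> ord c \<and> (z, y) \<in> ord c} > 0"
    using compact_tom unfolding tom_defs by (elim conjE)
  then show ?thesis using assms by blast
qed

lemma diffuse:
  assumes "x \<in> T"
  shows "emeasure \<mu> {x} = 0"
proof -
  have "\<forall>x\<in>T. emeasure \<mu> {x} = 0"
    using compact_tom unfolding tom_defs by (elim conjE)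
  then show ?thesis using assms by blast
qed

lemma le_refl: "x \<in> T \<Longrightarrow> le x x"
  using linear by (auto simp: linear_order_on_def partial_order_on_def preorder_on_def refl_on_def le_def)

lemma le_trans: "le x y \<Longrightarrow> le y z \<Longrightarrow> le x z"
  using linear unfolding linear_order_on_def partial_order_on_def preorder_on_def trans_def le_def by blast

lemma le_antisym: "le x y \<Longrightarrow> le y x \<Longrightarrow> x = y"
  using linear unfolding linear_order_on_def partial_order_on_def antisym_def le_def by blast

lemma le_total:
  assumes "x \<in> T" "y \<in> T"
  shows "le x y \<or> le y x"
proof -
  have "total_on T (ord c)" using linear by (simp add: linear_order_on_def)
  then show ?thesis using assms le_refl[of x] by (cases "x = y") (auto simp: total_on_def le_def)
qed

lemma le_root: "x \<in> T \<Longrightarrow> le x \<rho>"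
  using Or1[of \<rho> x] ancestor_iff[of x \<rho>] by (simp add: le_def)

lemma space_mass [simp]: "space \<mu> = T"
  using sets_eq_imp_space_eq[OF sets_mass] Metric_space_axioms by simp

lemma openin_sets: "openin mtopology U \<Longrightarrow> U \<in> sets \<mu>"
  using openin_sets_metric_borel[OF Metric_space_axioms] sets_mass by simp

lemma singleton_sets: "x \<in> T \<Longrightarrow> {x} \<in> sets \<mu>"
proof -
  assume x: "x \<in> T"
  then have "closedin mtopology {x}" using Hausdorff_space_mtopology by (simp add: closedin_Hausdorff_singleton)
  then have "openin mtopology (T - {x})" by (simp add: closedin_def)
  then have "T - (T - {x}) \<in> sets \<mu>" using openin_sets sets.compl_sets[of "T - {x}" \<mu>] by simp
  then show ?thesis using x by (simp add: double_diff)
qed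

section \<open>Finite mass and measurability of initial segments\<close>

lemma emeasure_finite: "emeasure \<mu> T < \<infinity>"
proof -
  define \<U> where "\<U> = {U. openin mtopology U \<and> emeasure \<mu> U < \<infinity>}"
  have "T \<subseteq> \<Union>\<U>" using locally_finite by (auto simp: \<U>_def)
  moreover have "\<forall>U\<in>\<U>. openin mtopology U" by (simp add: \<U>_def)
  moreover have "compactin mtopology T" using compact by (simp add: compact_space_def)
  ultimately obtain \<F> where \<F>: "finite \<F>" "\<F> \<subseteq> \<U>" "T \<subseteq> \<Union>\<F>" unfolding compactin_def by meson
  have sets: "\<F> \<subseteq> sets \<mu>" using \<F>(2) openin_sets by (auto simp: \<U>_def)
  have "emeasure \<mu> T \<le> emeasure \<mu> (\<Union>U\<in>\<F>. U)"
    using \<F> sets by (intro emeasure_mono) (auto intro!: sets.finite_UN)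
  also have "\<dots> \<le> (\<Sum>U\<in>\<F>. emeasure \<mu> U)"
    using \<F> sets by (intro emeasure_subadditive_finite) auto
  also have "\<dots> < \<infinity>" using \<F> by (auto simp: \<U>_def)
  finally show ?thesis .
qed

sublocale mass: finite_measure \<mu>
  using emeasure_finite by (intro finite_measureI) simp

definition down :: "'a \<Rightarrow> 'a set" where
  "down x = {z\<in>T. le z x}"

text \<open>Strict positivity of the mass of an interval already says that the interval is measurable,
  because non-measurable sets get the value \<open>0\<close>.\<close>

lemma interval_sets:
  assumes "x \<in> T" "y \<in> T" "le x y" "x \<noteq> y"
  shows "{z\<in>T. le x z \<and> le z y} \<in> sets \<mu>"
  using interval_pos[of x y] emeasure_notin_sets[of "{z\<in>T. le x z \<and> le z y}" \<mu>] assms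
  unfolding le_def by force

text \<open>The root is the greatest element, so the points above x form the order interval from x
  to the root, which is measurable; the initial segment is its complement together with x.\<close>

lemma down_sets:
  assumes x: "x \<in> T"
  shows "down x \<in> sets \<mu>"
proof -
  have "{z\<in>T. le x z} \<in> sets \<mu>"
  proof (cases "x = \<rho>")
    case True
    then have "{z\<in>T. le x z} = {\<rho>}" using le_root le_antisym le_refl by auto
    then show ?thesis using singleton_sets by simp
  next
    case False
    have "{z\<in>T. le x z} = {z\<in>T. le x z \<and> le z \<rho>}" using le_root by auto
    then show ?thesis using interval_sets[of x \<rho>] x False le_root by simp
  qed
  then have "(T - {z\<in>T. le x z}) \<union> {x} \<in> sets \<mu>"
    using singleton_sets[OF x] sets.compl_sets[of "{z\<in>T. le x z}" \<mu>] by (intro sets.Un) simp_all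
  moreover have "(T - {z\<in>T. le x z}) \<union> {x} = down x"
    using x le_total le_antisym le_refl by (auto simp: down_def)
  ultimately show ?thesis by simp
qed

definition F :: "'a \<Rightarrow> real" where
  "F x = measure \<mu> (down x)"

abbreviation m :: real where
  "m \<equiv> measure \<mu> T"

lemma measure_singleton: "x \<in> T \<Longrightarrow> measure \<mu> {x} = 0"
  using diffuse by (simp add: measure_def)

text \<open>The two initial segments differ by the interval from x to y without x, and removing x
  costs no mass.\<close>

lemma F_less:
  assumes "x \<in> T" "y \<in> T" "le x y" "x \<noteq> y"
  shows "F x < F y"
proof -
  let ?I = "{z\<in>T. le x z \<and> le z y}"
  have I: "?I \<in> sets \<mu>" using interval_sets assms by blast
  have "emeasure \<mu> ?I > 0" using interval_pos[of x y] assms unfolding le_def by blast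
  then have pos: "measure \<mu> ?I > 0"
    by (simp add: mass.emeasure_eq_measure)
  have "measure \<mu> (down y) = measure \<mu> (down x \<union> (?I - {x}))"
  proof (rule arg_cong[where f = "measure \<mu>"])
    show "down y = down x \<union> (?I - {x})"
      using assms le_total le_trans le_antisym le_refl unfolding down_def by blast
  qed
  also have "\<dots> = measure \<mu> (down x) + measure \<mu> (?I - {x})"
    using down_sets I singleton_sets assms le_antisym
    by (intro mass.finite_measure_Union) (auto simp: down_def)
  also have "measure \<mu> (?I - {x}) = measure \<mu> ?I - measure \<mu> {x}"
    using I singleton_sets assms le_refl by (intro mass.finite_measure_Diff) auto
  finally show ?thesis using pos measure_singleton assms by (simp add: F_def)
qed

lemma F_le_iff: "x \<in> T \<Longrightarrow> y \<in> T \<Longrightarrow> F x \<le> F y \<longleftrightarrow> le x y"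
  using F_less[of x y] F_less[of y x] le_total[of x y] by force

lemma F_eq_imp: "x \<in> T \<Longrightarrow> y \<in> T \<Longrightarrow> F x = F y \<Longrightarrow> x = y"
  using F_le_iff[of x y] F_le_iff[of y x] le_antisym by auto

lemma down_F: "x \<in> T \<Longrightarrow> down x = {z\<in>T. F z \<le> F x}"
  using F_le_iff by (auto simp: down_def)

lemma F_root: "F \<rho> = m"
proof -
  have "down \<rho> = T" using le_root by (auto simp: down_def)
  then show ?thesis by (simp add: F_def)
qed

lemma F_nonneg: "0 \<le> F x"
  by (simp add: F_def)

lemma F_le: "F x \<le> m"
  unfolding F_def using openin_sets[OF open_in_mspace]
  by (intro mass.finite_measure_mono) (auto simp: down_def)

text \<open>A nonempty sublevel set is an initial segment if its supremum of \<open>F\<close> is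
  attained, and otherwise a countable union of initial segments.\<close>

lemma F_measurable: "F \<in> borel_measurable \<mu>"
  unfolding borel_measurable_iff_le
proof
  fix a :: real
  define D where "D = {z\<in>T. F z \<le> a}"
  have "D \<in> sets \<mu>"
  proof (cases "D = {}")
    case False
    have bdd: "bdd_above (F ` D)" using F_le by (intro bdd_aboveI[of _ m]) auto
    define s where "s = Sup (F ` D)"
    have ub: "F z \<le> s" if "z \<in> D" for z using that bdd unfolding s_def by (auto intro: cSup_upper)
    show ?thesis
    proof (cases "\<exists>x\<in>D. F x = s")
      case True
      then obtain x where x: "x \<in> D" "F x = s" by blast
      have "D = down x" using x ub by (auto simp: down_F D_def)
      moreover have "x \<in> T" using x by (simp add: D_def)
      ultimately show ?thesis using down_sets by simp
    next
      case False
      have "\<exists>x\<in>D. s - inverse (real (Suc n)) < F x" for n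
      proof -
        have "s - inverse (real (Suc n)) < Sup (F ` D)" by (simp add: s_def)
        then show ?thesis using less_cSupD[of "F ` D"] \<open>D \<noteq> {}\<close> by blast
      qed
      then obtain x where x: "\<And>n. x n \<in> D" "\<And>n. s - inverse (real (Suc n)) < F (x n)" by metis
      have xT: "x n \<in> T" for n using x by (auto simp: D_def)
      have "D = (\<Union>n. down (x n))"
      proof (intro equalityI subsetI)
        fix z assume z: "z \<in> D"
        then have "F z < s" using ub False by (metis less_le)
        then obtain n where "inverse (real (Suc n)) < s - F z"
          using reals_Archimedean[of "s - F z"] by auto
        then have "F z \<le> F (x n)" using x(2)[of n] by linarith
        then show "z \<in> (\<Union>n. down (x n))" using z xT by (auto simp: down_F D_def)
      next
        fix z assume "z \<in> (\<Union>n. down (x n))"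
        then obtain n where "z \<in> down (x n)" by blast
        then show "z \<in> D" using x(1)[of n] xT[of n] by (simp add: down_F D_def)
      qed
      then show ?thesis using down_sets xT by auto
    qed
  qed simp
  then show "{w \<in> space \<mu>. F w \<le> a} \<in> sets \<mu>" by (simp add: D_def)
qed

lemma level_null: "measure \<mu> {z\<in>T. F z = t} = 0"
proof (cases "\<exists>x\<in>T. F x = t")
  case True
  then obtain x where x: "x \<in> T" "F x = t" by blast
  then have "{z\<in>T. F z = t} = {x}" using F_eq_imp by auto
  then show ?thesis using measure_singleton x by simp
next
  case False
  then have "{z\<in>T. F z = t} = {}" by auto
  then show ?thesis by (simp only: measure_empty)
qed

section \<open>The law of F is Lebesgue measure\<close>

definition law :: "real measure" where
  "law = distr \<mu> borel F"

sublocale law: finite_borel_measure law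
proof -
  have "finite_measure law" unfolding law_def by (rule mass.finite_measure_distr[OF F_measurable])
  then show "finite_borel_measure law"
    by (simp add: finite_borel_measure_def finite_borel_measure_axioms_def law_def)
qed

lemma measure_law:
  assumes "A \<in> sets borel"
  shows "measure law A = measure \<mu> {z\<in>T. F z \<in> A}"
proof -
  have "F -` A \<inter> T = {z\<in>T. F z \<in> A}" by auto
  then show ?thesis using measure_distr[OF F_measurable assms] by (simp add: law_def)
qed

lemma cdf_law: "cdf law t = measure \<mu> {z\<in>T. F z \<le> t}"
  by (simp add: cdf_def measure_law)

lemma cdf_law_F: "x \<in> T \<Longrightarrow> cdf law (F x) = F x"
  unfolding cdf_law by (metis F_def down_F)

text \<open>Level sets of \<open>F\<close> have at most one point, so diffuseness makes the
  distribution function continuous.\<close>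

lemma closed_fixpoints: "closed {t. cdf law t = t}"
proof (rule closed_Collect_eq)
  have "isCont (cdf law) t" for t
    using law.isCont_cdf[of t] level_null[of t] by (simp add: measure_law)
  then show "continuous_on UNIV (cdf law)" by (simp add: continuous_on_eq_continuous_at)
qed simp

text \<open>The distribution function fixes the range of \<open>F\<close>, hence, being continuous, its closure; the
  gaps of this closure carry no mass and are therefore empty.\<close>

lemma cdf_law_id:
  assumes "0 \<le> t" "t \<le> m"
  shows "cdf law t = t"
proof (rule antisym)
  have range: "cdf law s = s" if "s \<in> closure (F ` D)" "D \<subseteq> T" for D s
  proof -
    have "closure (F ` D) \<subseteq> {t. cdf law t = t}"
      using closed_fixpoints cdf_law_F that(2) by (intro closure_minimal) auto
    then show ?thesis using that(1) by auto
  qed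
  show "cdf law t \<le> t"
  proof (cases "{z\<in>T. F z \<le> t} = {}")
    case True
    then have "cdf law t = 0" unfolding cdf_law by (simp only: measure_empty)
    then show ?thesis using assms by simp
  next
    case False
    \<comment> \<open>No value of \<open>F\<close> lies between s and t, so the distribution
      function takes the same value at both, and s is a fixed point in the closure of the
      range.\<close>
    define D where "D = {z\<in>T. F z \<le> t}"
    define s where "s = Sup (F ` D)"
    have ne: "F ` D \<noteq> {}" using False by (simp add: D_def)
    have bdd: "bdd_above (F ` D)" by (rule bdd_aboveI[of _ t]) (auto simp: D_def)
    have st: "s \<le> t" unfolding s_def using ne by (rule cSup_least) (auto simp: D_def)
    have ub: "F z \<le> s" if "z \<in> D" for z using that bdd unfolding s_def by (auto intro: cSup_upper)
    have "{z\<in>T. F z \<le> t} = {z\<in>T. F z \<le> s}" using st ub by (auto simp: D_def)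
    then have "cdf law t = cdf law s" by (simp add: cdf_law)
    also have "\<dots> = s"
      using closure_contains_Sup[OF ne bdd] by (intro range[of s D]) (auto simp: s_def D_def)
    finally show ?thesis using st by simp
  qed
  \<comment> \<open>Dually, from t up to the infimum s of the later values only s itself can be a
    new value, and its level set is null.\<close>
  define U where "U = {z\<in>T. t \<le> F z}"
  define s where "s = Inf (F ` U)"
  have "\<rho> \<in> U" using assms F_root by (simp add: U_def)
  then have ne: "F ` U \<noteq> {}" by blast
  have bdd: "bdd_below (F ` U)" by (rule bdd_belowI[of _ t]) (auto simp: U_def)
  have st: "t \<le> s" unfolding s_def using ne by (rule cInf_greatest) (auto simp: U_def)
  have lb: "s \<le> F z" if "z \<in> U" for z using that bdd unfolding s_def by (auto intro: cInf_lower)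
  have "s = cdf law s"
    using closure_contains_Inf[OF ne bdd] by (intro range[of s U, symmetric]) (auto simp: s_def U_def)
  also have "\<dots> = measure law {..s}" by (simp add: cdf_def)
  also have "\<dots> = measure \<mu> {z\<in>T. F z \<in> {..s}}" by (simp add: measure_law)
  also have "\<dots> = measure \<mu> {z\<in>T. F z \<in> {..t} \<union> {s}}"
  proof (rule arg_cong[where f = "measure \<mu>"])
    show "{z\<in>T. F z \<in> {..s}} = {z\<in>T. F z \<in> {..t} \<union> {s}}"
      using st lb by (force simp: U_def)
  qed
  also have "\<dots> = measure law ({..t} \<union> {s})" by (subst measure_law) auto
  also have "\<dots> \<le> measure law {..t} + measure law {s}"
    by (rule measure_Un_le) auto
  also have "measure law {s} = 0" using level_null by (simp add: measure_law)
  finally show "t \<le> cdf law t" using st by (simp add: cdf_def)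
qed

lemma F_dense:
  assumes "0 \<le> s" "s < t" "t \<le> m"
  shows "\<exists>y\<in>T. s < F y \<and> F y < t"
proof (rule ccontr)
  assume none: "\<not> (\<exists>y\<in>T. s < F y \<and> F y < t)"
  \<comment> \<open>An inner point is used because t itself may be a value of \<open>F\<close>. A
    gap would make the distribution function constant from s to u, but it is the identity.\<close>
  obtain u where u: "s < u" "u < t" using dense assms by blast
  have "{z\<in>T. F z \<le> s} = {z\<in>T. F z \<le> u}" using none u by force
  then have "cdf law s = cdf law u" by (simp add: cdf_law)
  then show False using cdf_law_id[of s] cdf_law_id[of u] u assms by simp
qed

lemma law_eq_lborel: "law = distr (restrict_space lborel {0..m}) borel (\<lambda>x. x)"
proof (rule measure_eqI_lessThan)
  let ?N = "distr (restrict_space lborel {0..m}) borel (\<lambda>x. x)"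
  show "sets law = sets borel" "sets ?N = sets borel" by (simp_all add: law_def)
  show "emeasure law {x<..} < \<infinity>" for x
    by (metis law.emeasure_finite infinity_ennreal_def top.not_eq_extremum)
  show "emeasure law {x<..} = emeasure ?N {x<..}" for x
  proof -
    have meas: "(\<lambda>x. x) \<in> measurable (restrict_space lborel {0..m}) borel"
      by (rule measurable_restrict_space1) simp
    have N: "emeasure ?N {x<..} = emeasure lborel ({x<..} \<inter> {0..m})"
      using emeasure_distr[OF meas, of "{x<..}"]
      by (simp add: space_restrict_space emeasure_restrict_space Int_commute)
    have "measure law UNIV = measure law {..x} + measure law {x<..}"
      by (subst law.finite_measure_Union[symmetric]) (auto intro: arg_cong[where f = "measure law"])
    moreover have "measure law UNIV = m" by (simp add: measure_law)
    ultimately have L: "emeasure law {x<..} = ennreal (m - cdf law x)"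
      by (simp add: law.emeasure_eq_measure cdf_def)
    consider "x < 0" | "0 \<le> x" "x < m" | "m \<le> x" by linarith
    then show ?thesis
    proof cases
      case 1
      then have "{z\<in>T. F z \<le> x} = {}" using F_nonneg by (auto simp: not_le intro: less_le_trans)
      then have "cdf law x = 0" unfolding cdf_law by (simp only: measure_empty)
      moreover have "{x<..} \<inter> {0..m} = {0..m}" using 1 by auto
      ultimately show ?thesis by (simp add: L N)
    next
      case 2
      then have "cdf law x = x" using cdf_law_id by simp
      moreover have "{x<..} \<inter> {0..m} = {x<..m}" using 2 by auto
      ultimately show ?thesis using 2 by (simp add: L N)
    next
      case 3
      then have "{z\<in>T. F z \<le> x} = T" using F_le order_trans by blast
      then have "cdf law x = m" by (simp add: cdf_law)
      moreover have "{x<..} \<inter> {0..m} = {}" using 3 by auto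
      ultimately show ?thesis by (simp add: L N)
    qed
  qed
qed

lemma explored: "explored_tree T d \<rho> F m"
proof
  show "compact_space mtopology" by (rule compact)
  show "0 \<le> F x" "F x \<le> m" for x by (rule F_nonneg, rule F_le)
  show "inj_on F T" using F_eq_imp by (auto intro: inj_onI)
  show "F \<rho> = m" by (rule F_root)
  show "F x \<le> F z" if "z \<in> T" "x \<in> T" "below z x" for z x
    using Or1[of z x] ancestor_iff[of x z] F_le_iff[of x z] that by (simp add: le_def)
  show "F z < F y" if "z \<in> T" "x \<in> T" "y \<in> T" "below z x" "\<not> below z y" "F x < F y" for z x y
  proof -
    have "le x y" "x \<noteq> y" using that F_le_iff[of x y] by auto
    then have "le z y \<and> z \<noteq> y"
      using Or2[of x y z] in_segment_branch_point[of z x y] that by (simp add: le_def)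
    then show ?thesis using F_less that by blast
  qed
  show "\<exists>y\<in>T. s < F y \<and> F y < t" if "0 \<le> s" "s < t" "t \<le> m" for s t
    using that by (rule F_dense)
qed

sublocale explored_tree T d \<rho> F m by (rule explored)

section \<open>The tree coded by the contour function\<close>

sublocale nonneg_code m contour
  using coding_function_contour by unfold_locales (auto simp: coding_function_def)

text \<open>Right-continuity makes the preimage in \<open>[0, m)\<close> open to the right; the
  endpoint m has no room on its right and is added separately.\<close>

lemma explore_borel:
  assumes U: "openin mtopology U"
  shows "{t\<in>{0..m}. explore t \<in> U} \<in> sets borel"
proof -
  define S where "S = {t\<in>{0..<m}. explore t \<in> U}"
  have "S \<in> sets borel"
  proof (rule right_open_borel)
    fix t assume t: "t \<in> S"
    then obtain r where r: "r > 0" "mball (explore t) r \<subseteq> U"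
      using U by (auto simp: openin_mtopology S_def)
    have t0: "0 \<le> t" "t < m" using t by (auto simp: S_def)
    obtain \<delta> where \<delta>: "\<delta> > 0" "\<And>s. t < s \<Longrightarrow> s < t + \<delta> \<Longrightarrow> s \<le> m \<Longrightarrow> d (explore t) (explore s) < r"
      using explore_right[OF t0 r(1)] by metis
    have "{t<..<min m (t + \<delta>)} \<subseteq> S"
    proof
      fix s assume s: "s \<in> {t<..<min m (t + \<delta>)}"
      then have "explore s \<in> mball (explore t) r"
        using \<delta>(2)[of s] explore_in[of s] explore_in[of t] t0 by auto
      then show "s \<in> S" using r(2) s t0 by (auto simp: S_def)
    qed
    then show "\<exists>e>t. {t<..<e} \<subseteq> S" using t0 \<delta>(1) by (intro exI[of _ "min m (t + \<delta>)"]) auto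
  qed
  moreover have "{t\<in>{0..m}. explore t \<in> U} = S \<or> {t\<in>{0..m}. explore t \<in> U} = insert m S"
  proof (cases "explore m \<in> U")
    case True
    then have "{t\<in>{0..m}. explore t \<in> U} = insert m S"
      using m_nonneg by (auto simp: S_def order_le_less)
    then show ?thesis ..
  next
    case False
    then have "{t\<in>{0..m}. explore t \<in> U} = S" by (auto simp: S_def order_le_less)
    then show ?thesis ..
  qed
  ultimately show ?thesis by auto
qed

lemma explore_measurable: "explore \<in> measurable (restrict_space lborel {0..m}) \<mu>"
proof -
  have "explore \<in> measurable (restrict_space lborel {0..m}) (metric_borel T d)"
  proof (rule measurable_metric_borelI[OF Metric_space_axioms])
    fix U assume "openin mtopology U"
    then have "{t\<in>{0..m}. explore t \<in> U} \<in> sets borel" by (rule explore_borel)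
    moreover have "explore -` U \<inter> {0..m} = {t\<in>{0..m}. explore t \<in> U}" by auto
    ultimately show "explore -` U \<inter> space (restrict_space lborel {0..m}) \<in> sets (restrict_space lborel {0..m})"
      by (auto simp: space_restrict_space sets_restrict_space_iff)
  qed (use explore_in in \<open>auto simp: space_restrict_space\<close>)
  then show ?thesis by (simp add: sets_mass cong: measurable_cong_sets)
qed

text \<open>Since \<open>explore\<close> is a left inverse of \<open>F\<close> and \<open>F\<close> carries \<open>\<mu>\<close> to Lebesgue measure,
  \<open>explore\<close> carries Lebesgue measure back to \<open>\<mu>\<close>.\<close>

lemma distr_explore: "distr (restrict_space lborel {0..m}) \<mu> explore = \<mu>"
proof (rule measure_eqI)
  fix A assume "A \<in> sets (distr (restrict_space lborel {0..m}) \<mu> explore)"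
  then have A: "A \<in> sets \<mu>" by simp
  let ?L = "restrict_space lborel {0..m}"
  define P where "P = {t\<in>{0..m}. explore t \<in> A}"
  have P': "explore -` A \<inter> space ?L = P" by (auto simp: P_def space_restrict_space)
  have PL: "P \<in> sets ?L" using measurable_sets[OF explore_measurable A] P' by simp
  then have P: "P \<in> sets borel" by (simp add: sets_restrict_space_iff)
  have meas: "(\<lambda>x. x) \<in> measurable ?L borel"
    by (rule measurable_restrict_space1) simp
  have "emeasure (distr ?L \<mu> explore) A = emeasure ?L P"
    using emeasure_distr[OF explore_measurable A] P' by simp
  also have "\<dots> = emeasure law P"
    using emeasure_distr[OF meas P] sets.sets_into_space[OF PL]
    by (simp add: law_eq_lborel Int_absorb2 space_restrict_space)
  also have "\<dots> = emeasure \<mu> (F -` P \<inter> T)"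
    using emeasure_distr[OF F_measurable P] by (simp add: law_def)
  also have "F -` P \<inter> T = A"
    using explore_F F_nonneg F_le sets.sets_into_space[OF A] by (auto simp: P_def)
  finally show "emeasure (distr ?L \<mu> explore) A = emeasure \<mu> A" .
qed simp

section \<open>The isomorphism with the coded tree\<close>

definition cls :: "real \<Rightarrow> real set" where
  "cls t = code_equiv m contour `` {t}"

lemma cls_eq: "t \<in> {0..m} \<Longrightarrow> cls t = {s\<in>{0..m}. explore s = explore t}"
  using code_dist_contour[of t] explore_in by (auto simp: cls_def code_equiv_def)

lemma Sup_cls:
  assumes "t \<in> {0..m}"
  shows "Sup (cls t) = F (explore t)"
proof (rule cSup_eq_maximum)
  show "F (explore t) \<in> cls t"
    using explore_F[of "explore t"] explore_in assms F_nonneg F_le by (auto simp: cls_eq)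
  show "s \<le> F (explore t)" if "s \<in> cls t" for s
    using that le_F_explore[of s] assms by (auto simp: cls_eq)
qed

lemma tom_isomorphic_contour: "tom_isomorphic (coded_tree m contour) c"
proof -
  \<comment> \<open>The supremum of a class is a member of it (\<open>Sup_cls\<close>), so it serves
    as a canonical representative and directly carries the order of the coded tree.\<close>
  define h where "h A = explore (Sup A)" for A :: "real set"
  have h: "h (cls t) = explore t" if "t \<in> {0..m}" for t
    using Sup_cls[OF that] explore_F explore_in that by (simp add: h_def)
  have Q: "Q = cls ` {0..m}" by (auto simp: quotient_def cls_def)
  have hQ: "h ` Q = T"
  proof -
    have "explore ` {0..m} = T"
      using explore_in explore_F F_nonneg F_le by (force simp: image_iff)
    then show ?thesis by (simp add: Q image_image h cong: image_cong_simp)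
  qed
  have dist: "d (h A) (h B) = quotient_dist m contour A B" if "A \<in> Q" "B \<in> Q" for A B
    using that quotient_dist_class code_dist_contour by (auto simp: Q h cls_def[symmetric])
  have order: "(h A, h B) \<in> ord c \<longleftrightarrow> Sup A \<le> Sup B" if "A \<in> Q" "B \<in> Q" for A B
    using that F_le_iff explore_in by (auto simp: Q h Sup_cls le_def)
  let ?L = "restrict_space lborel {0..m}"
  let ?B = "metric_borel Q (quotient_dist m contour)"
  have hm: "h \<in> measurable ?B \<mu>"
    using isometry_measurable[OF Metric_space_quotient Metric_space_axioms, of h] hQ dist
    by (simp add: sets_mass cong: measurable_cong_sets)
  have cm: "cls \<in> measurable ?L ?B"
  proof (rule measurable_metric_borelI[OF Metric_space_quotient])
    show "cls \<in> space ?L \<rightarrow> Q" by (auto simp: Q space_restrict_space)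
    fix V assume V: "openin (Metric_space.mtopology Q (quotient_dist m contour)) V"
    interpret Q: Metric_space Q "quotient_dist m contour" by (rule Metric_space_quotient)
    have VQ: "V \<subseteq> Q" using openin_subset[OF V] by simp
    have inj: "A = B" if "A \<in> Q" "B \<in> Q" "h A = h B" for A B
    proof -
      have "h B \<in> T" using that hQ by blast
      then have "quotient_dist m contour A B = 0" using dist[OF that(1,2)] that(3) by simp
      then show ?thesis using Q.zero that by blast
    qed
    \<comment> \<open>The inverse of h is an isometry with \<open>g (explore t) = cls t\<close>, so
      the preimage of V under the projection is the preimage under \<open>explore\<close> of an open
      subset of the tree.\<close>
    define g where "g = inv_into Q h"
    have g: "g x \<in> Q" "h (g x) = x" if "x \<in> T" for x
      using that inv_into_into[of x h Q] f_inv_into_f[of x h Q] hQ by (auto simp: g_def)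
    have gh: "g (h A) = A" if "A \<in> Q" for A using inj[OF g(1)] g(2) that hQ by blast
    have "openin mtopology (g -` V \<inter> T)"
    proof (rule openin_isometry_vimage[OF Metric_space_axioms Metric_space_quotient _ _ V])
      show "quotient_dist m contour (g x) (g y) = d x y" if "x \<in> T" "y \<in> T" for x y
        using dist[of "g x" "g y"] g that by simp
    qed (use g in auto)
    then have "{t\<in>{0..m}. explore t \<in> g -` V \<inter> T} \<in> sets borel" by (rule explore_borel)
    moreover have "g (explore t) = cls t" if "t \<in> {0..m}" for t
      using gh[of "cls t"] h[OF that] that by (simp add: Q)
    then have "cls -` V \<inter> {0..m} = {t\<in>{0..m}. explore t \<in> g -` V \<inter> T}"
      using explore_in by auto
    ultimately show "cls -` V \<inter> space ?L \<in> sets ?L"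
      by (auto simp: space_restrict_space sets_restrict_space_iff)
  qed
  have "distr (distr ?L ?B cls) \<mu> h = distr ?L \<mu> (h \<circ> cls)"
    using hm cm by (rule distr_distr)
  also have "\<dots> = distr ?L \<mu> explore"
    by (rule distr_cong) (auto simp: h space_restrict_space)
  finally have "distr (distr ?L ?B cls) \<mu> h = \<mu>" by (simp add: distr_explore)
  then show ?thesis
    unfolding tom_isomorphic_def coded_tree_def Let_def using hQ dist order
    by (intro exI[of _ h]) (simp add: cls_def[abs_def])
qed

lemma codes_contour: "codes contour c"
  using coding_function_contour tom_isomorphic_contour by (simp add: codes_def total_mass_def)

end

theorem theorem1:
  shows "(\<forall>c :: 'a tom_structure. compact_TOM_tree c \<longrightarrow> (\<exists>f. codes f c)) \<and>
         (\<forall>(c :: 'a tom_structure) (c' :: 'b tom_structure) f f'.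
            compact_TOM_tree c \<and> compact_TOM_tree c' \<and> \<not> tom_isomorphic c c' \<and>
            codes f c \<and> codes f' c' \<longrightarrow>
            \<not> (total_mass c = total_mass c' \<and> (\<forall>t\<in>{0..total_mass c}. f t = f' t)))"
proof (intro conjI allI impI notI)
  fix c :: "'a tom_structure"
  assume "compact_TOM_tree c"
  then interpret compact_tom c by (rule compact_tom.intro)
  show "\<exists>f. codes f c" using codes_contour by blast
next
  fix c :: "'a tom_structure" and c' :: "'b tom_structure" and f f'
  assume c: "compact_TOM_tree c \<and> compact_TOM_tree c' \<and> \<not> tom_isomorphic c c' \<and>
      codes f c \<and> codes f' c'"
    and eq: "total_mass c = total_mass c' \<and> (\<forall>t\<in>{0..total_mass c}. f t = f' t)"
  interpret c: compact_tom c using c by (intro compact_tom.intro) simp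
  interpret c': compact_tom c' using c by (intro compact_tom.intro) simp
  \<comment> \<open>Equal mass and equal values on \<open>[0, m]\<close> give one coded tree q,
    which is isomorphic to both trees.\<close>
  define q where "q = coded_tree (total_mass c) f"
  have same: "q = coded_tree (total_mass c') f'"
    using eq coded_tree_cong[of "total_mass c" f f'] by (simp add: q_def)
  have iso: "tom_isomorphic q c" "tom_isomorphic q c'"
    using c same by (simp_all add: codes_def q_def)
  have "nonneg_code (total_mass c) f"
    using c by (intro nonneg_code.intro) (simp add: codes_def coding_function_def)
  then have "Metric_space (points q) (distance q)"
    using nonneg_code.Metric_space_quotient by (simp add: q_def coded_tree_def Let_def)
  moreover have "sets (mass q) = sets (metric_borel (points q) (distance q))"
    by (simp add: q_def coded_tree_def Let_def)
  ultimately have "tom_isomorphic c c'"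
    using c.Metric_space_axioms c.sets_mass c'.Metric_space_axioms c'.sets_mass iso
    by (rule tom_isomorphic_common_source)
  then show False using c by simp
qed

end
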